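(* Let $A$ be a positively graded Cohen–Macaulay domain of Krull dimension $d$, with Hilbert series $\operatorname{Hilb}_A(t)$ and $a$-invariant $a$, and assume that $A$ is Gorenstein. Put $$\varphi_A(z):=z^d\operatorname{Hilb}_A(1-z),\qquad s:=-(a+d).$$ Then for every formal power series $h\in\mathbb C[[z]]$ and every integer $n\ge0$, $$[z^n]\,h(z)\varphi_A(z)=[z^n]\,h\!\left(\frac{z}{1+z}\right)(1+z)^{n-1+s}\varphi_A(-z).$$
   Context: $[z^n]H(z)$ denotes the coefficient of $z^n$ in the formal power series $H(z)$. Here a positively graded domain means a finitely generated commutative algebra $A=\bigoplus_{i\ge0}A_i$ over a field $K=A_0$ which is an integral domain; $\operatorname{Hilb}_A(t)=\sum_{i\ge0}\dim_K(A_i)t^i$, a rational function of $t$ with a pole of order $d$ at $t=1$, so that $\varphi_A(z)$ (the rational function expanded at $z=0$) is a formal power series. The $a$-invariant $a$ of the Cohen–Macaulay algebra $A$ is the degree of $\operatorname{Hilb}_A(t)$ as a rational function. Stanley's theorem states that for such a Cohen–Macaulay domain, $A$ is Gorenstein if and only if $\operatorname{Hilb}_A(t^{-1})=(-1)^dt^{-a}\operatorname{Hilb}_A(t)$. *)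

theory Defs
  imports
    "HOL-Algebra.Algebra"
    "HOL-Computational_Algebra.Computational_Algebra"
    "HOL-Library.Extended_Nat"
begin

text \<open>
  A positively graded domain: the ground field is the degree-zero part \<open>A 0\<close>, a subset of the
  carrier, and the scalar action of the \<open>A 0\<close>-algebra structure is the multiplication of \<open>R\<close>.
\<close>

locale positively_graded_domain = domain R for R (structure) +
  fixes A :: "nat \<Rightarrow> 'a set"
  assumes additive: "\<And>i. additive_subgroup (A i) R"
    and mult_degree: "\<And>i j x y. x \<in> A i \<Longrightarrow> y \<in> A j \<Longrightarrow> x \<otimes> y \<in> A (i + j)"
    and direct_sum: "\<And>x. x \<in> carrier R \<Longrightarrow>
      \<exists>!f. (\<forall>i. f i \<in> A i) \<and> finite {i. f i \<noteq> \<zero>} \<and> x = (\<Oplus>i\<in>{i. f i \<noteq> \<zero>}. f i)"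
    and ground_field: "subfield (A 0) R"
    and finitely_generated: "\<exists>S. finite S \<and> S \<subseteq> carrier R \<and> generate_ring R (A 0 \<union> S) = carrier R"

definition krull_dim :: "('a, 'b) ring_scheme \<Rightarrow> enat" where
  "krull_dim R = Sup {enat n | n. \<exists>p :: nat \<Rightarrow> 'a set.
     (\<forall>i\<le>n. primeideal (p i) R) \<and> (\<forall>i<n. p i \<subset> p (Suc i))}"

text \<open>
  Homogeneous regular sequences in the irrelevant ideal \<open>A\<^sub>+\<close>: each member is a nonzerodivisor
  modulo the ideal generated by its predecessors.
\<close>

definition homogeneous_regular_sequence ::
    "('a, 'b) ring_scheme \<Rightarrow> (nat \<Rightarrow> 'a set) \<Rightarrow> 'a list \<Rightarrow> bool" where
  "homogeneous_regular_sequence R A \<theta> \<longleftrightarrow>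
     (\<forall>t\<in>set \<theta>. \<exists>i>0. t \<in> A i) \<and>
     (\<forall>i<length \<theta>. \<forall>x\<in>carrier R. (\<theta> ! i) \<otimes>\<^bsub>R\<^esub> x \<in> genideal R (set (take i \<theta>))
        \<longrightarrow> x \<in> genideal R (set (take i \<theta>))) \<and>
     genideal R (set \<theta>) \<noteq> carrier R"

definition graded_depth :: "('a, 'b) ring_scheme \<Rightarrow> (nat \<Rightarrow> 'a set) \<Rightarrow> enat" where
  "graded_depth R A = Sup {enat (length \<theta>) | \<theta>. homogeneous_regular_sequence R A \<theta>}"

definition cohen_macaulay :: "('a, 'b) ring_scheme \<Rightarrow> (nat \<Rightarrow> 'a set) \<Rightarrow> bool" where
  "cohen_macaulay R A \<longleftrightarrow> graded_depth R A = krull_dim R"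

text \<open>
  The socle of \<open>R/I\<close> is the annihilator of the image of \<open>A\<^sub>+\<close>.
\<close>

definition quotient_socle ::
    "('a, 'b) ring_scheme \<Rightarrow> (nat \<Rightarrow> 'a set) \<Rightarrow> 'a set \<Rightarrow> 'a set set" where
  "quotient_socle R A I =
     {x \<in> carrier (R Quot I). \<forall>i>0. \<forall>y\<in>A i. x \<otimes>\<^bsub>R Quot I\<^esub> (I +>\<^bsub>R\<^esub> y) = \<zero>\<^bsub>R Quot I\<^esub>}"

text \<open>
  Gorenstein means Cohen--Macaulay of type one: for a maximal homogeneous regular sequence
  \<open>\<theta>\<close> the socle of \<open>R/(\<theta>)\<close> is a line over the ground field.  The type of a Cohen--Macaulay
  algebra does not depend on \<open>\<theta>\<close>, so asking for one such sequence or for all of them is the same.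
\<close>

definition gorenstein :: "('a, 'b) ring_scheme \<Rightarrow> (nat \<Rightarrow> 'a set) \<Rightarrow> bool" where
  "gorenstein R A \<longleftrightarrow> cohen_macaulay R A \<and>
     (\<exists>\<theta>. homogeneous_regular_sequence R A \<theta> \<and> enat (length \<theta>) = graded_depth R A \<and>
        (let I = genideal R (set \<theta>)
         in ring.dimension (R Quot I) 1 ((\<lambda>k. I +>\<^bsub>R\<^esub> k) ` A 0) (quotient_socle R A I)))"

definition hilbert_series :: "('a, 'b) ring_scheme \<Rightarrow> (nat \<Rightarrow> 'a set) \<Rightarrow> complex fps" where
  "hilbert_series R A = Abs_fps (\<lambda>i. of_nat (ring.dim R (A 0) (A i)))"

text \<open>
  \<open>represents_rational H P Q\<close>: the power series \<open>H\<close> is the expansion at \<open>0\<close> of the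
  rational function \<open>P/Q\<close>.
\<close>

definition represents_rational ::
    "complex fps \<Rightarrow> complex poly \<Rightarrow> complex poly \<Rightarrow> bool" where
  "represents_rational H P Q \<longleftrightarrow> Q \<noteq> 0 \<and> H * fps_of_poly Q = fps_of_poly P"

definition a_invariant :: "('a, 'b) ring_scheme \<Rightarrow> (nat \<Rightarrow> 'a set) \<Rightarrow> int" where
  "a_invariant R A = (THE a. \<exists>P Q. represents_rational (hilbert_series R A) P Q \<and>
     a = int (degree P) - int (degree Q))"

text \<open>
  The expansion at \<open>z = 0\<close> of \<open>z\<^sup>d P(1 - z) / Q(1 - z)\<close>, where the Hilbert series is \<open>P/Q\<close>.
  Denominators are cleared because \<open>Q(1 - z)\<close> vanishes at \<open>0\<close> when \<open>d > 0\<close>; as power series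
  form an integral domain, at most one \<open>f\<close> satisfies the equation, and every choice of \<open>P\<close>, \<open>Q\<close>
  gives the same one.
\<close>

definition phi_series :: "('a, 'b) ring_scheme \<Rightarrow> (nat \<Rightarrow> 'a set) \<Rightarrow> nat \<Rightarrow> complex fps" where
  "phi_series R A d = (THE f. \<exists>P Q. represents_rational (hilbert_series R A) P Q \<and>
     f * fps_of_poly (pcompose Q [:1, -1:]) = fps_X ^ d * fps_of_poly (pcompose P [:1, -1:]))"

end

theory Submission
  imports Defs
begin

text \<open>
  Let \<open>\<theta>\<close> be a homogeneous regular sequence of length \<open>d\<close>, with degrees \<open>e\<^sub>1, \<dots>, e\<^sub>d\<close>, such that the
  socle of \<open>R/(\<theta>)\<close> is a line.  As \<open>d\<close> is the Krull dimension, no prime containing \<open>\<theta>\<close> lies strictly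
  below \<open>A\<^sub>+\<close>, for below any such prime there is a chain of length \<open>d\<close>; so every homogeneous element of
  positive degree is nilpotent modulo \<open>(\<theta>)\<close>, and \<open>R/(\<theta>)\<close> vanishes in high degrees.  Hence the Hilbert
  series times \<open>\<Prod>(1 - t^e\<^sub>i)\<close> is the polynomial \<open>p\<close> of dimensions of the graded pieces of \<open>R/(\<theta>)\<close>.
  The socle is concentrated in one degree \<open>\<sigma>\<close>, and multiplication into degree \<open>\<sigma>\<close> is a perfect
  pairing between degrees \<open>i\<close> and \<open>\<sigma> - i\<close>; so \<open>p\<close> is palindromic.  This gives
  \<open>\<phi>(z/(1+z)) = (1+z)^s \<phi>(-z)\<close>, and the corollary is the identity
  \<open>[z^n] F(z) = [z^n] F(z/(1+z)) (1+z)^(n-1)\<close> for \<open>F = h \<phi>\<close>.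
\<close>

subsection \<open>The substitution \<open>z \<mapsto> z/(1+z)\<close>\<close>

text \<open>The exponent \<open>n - 1\<close> is a Jacobian: \<open>[z^n] F\<close> is the residue
  of \<open>F(w) dw / w^(n+1)\<close>, and \<open>w = z/(1+z)\<close> with
  \<open>dw = dz/(1+z)^2\<close> turns this form into
  \<open>F(z/(1+z)) (1+z)^(n-1) dz / z^(n+1)\<close>. The substitution comes from the symmetry
  \<open>t -> 1/t\<close>: in the coordinate \<open>z = 1 - t\<close> it reads
  \<open>z -> -z/(1-z)\<close>, which fixes \<open>0\<close>, and replacing \<open>z\<close> by
  \<open>-z\<close> gives \<open>z/(1+z)\<close>. Hence the functional equation of the Hilbert
  series, written at \<open>t = 1\<close>, compares two power series at one and the same point.
  Since Gorenstein is given as type one, that functional equation has to be extracted from the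
  socle. Dimensions are computed inside \<open>R\<close> over the subfield \<open>A 0\<close>: the
  degree \<open>n\<close> piece of \<open>R/I\<close> is measured by \<open>A n\<close> and
  \<open>I \<inter> A n\<close>, and statements about \<open>R/I\<close> become congruences modulo
  \<open>I\<close>. The quotient ring itself appears only where the socle hypothesis is
  unpacked.\<close>

lemma fps_binomial_of_int:
  "fps_binomial (of_int k :: 'a :: field_char_0) = (1 + fps_X) powi k"
proof (cases "k \<ge> 0")
  case True
  then show ?thesis
    using fps_binomial_of_nat[of "nat k", where 'a='a] by (simp add: power_int_def)
next
  case False
  then have k: "(of_int k :: 'a) = - of_nat (nat (- k))"
    by simp
  have "fps_binomial (- of_nat m :: 'a) = inverse (1 + fps_X) ^ m" for m
    using fps_binomial_power[of "- 1 :: 'a" m] by (simp add: fps_binomial_minus_one)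
  then have "fps_binomial (of_int k :: 'a) = inverse (1 + fps_X) ^ nat (- k)"
    unfolding k .
  with False show ?thesis
    by (simp add: power_int_def)
qed

text \<open>With \<open>1/(1+z)\<close> written as a binomial series, powers of \<open>1+z\<close>
  of either sign are treated alike: their exponents simply add.\<close>

lemma fps_X_div_1_plus_X:
  "fps_X / (1 + fps_X) = fps_X * (fps_binomial (- 1) :: 'a :: field_char_0 fps)"
  by (simp add: fps_divide_unit fps_binomial_minus_one)

text \<open>By linearity it suffices to look at \<open>z^i\<close>, which becomes
  \<open>z^i (1+z)^(n-1-i)\<close>. Its coefficient at \<open>n\<close> is the binomial
  \<open>(n-1-i choose n-i)\<close>, which is zero for \<open>i < n\<close> and one for
  \<open>i = n\<close>.\<close>

lemma coeff_fps_compose_X_div_1_plus_X: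
  fixes f :: "'a :: field_char_0 fps"
  shows "fps_nth ((f oo (fps_X / (1 + fps_X))) * fps_binomial (of_int (int n - 1))) n = fps_nth f n"
proof -
  define g :: "'a fps" where "g = fps_X / (1 + fps_X)"
  define W :: "'a fps" where "W = fps_binomial (of_int (int n - 1))"
  have g0: "fps_nth g 0 = 0"
    by (simp add: g_def fps_X_div_1_plus_X)
  have gW: "g ^ i * W = fps_X ^ i * fps_binomial (of_int (int n - 1 - int i))" for i
    by (simp add: g_def W_def fps_X_div_1_plus_X power_mult_distrib fps_binomial_power mult.assoc
        flip: fps_binomial_add_mult)
  have coeff: "fps_nth (g ^ i * W) n = (if i = n then 1 else 0)" if "i \<le> n" for i
  proof -
    define m where "m = n - i"
    have "int n - 1 - int i = int m - 1" "n = i + m"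
      using that by (auto simp: m_def)
    \<comment> \<open>For \<open>m > 0\<close> the upper entry is a natural number just below
      \<open>m\<close>; for \<open>m = 0\<close> it is \<open>-1\<close>, whence the generalized
      binomial.\<close>
    moreover have "(of_int (int m - 1) gchoose m) = (if m = 0 then 1 else 0 :: 'a)"
    proof (cases m)
      case (Suc l)
      then show ?thesis
        by (simp add: binomial_eq_0 flip: binomial_gbinomial)
    qed simp
    ultimately show ?thesis
      unfolding gW by (simp add: fps_X_power_mult_nth)
  qed
  have "fps_nth ((f oo g) * W) n = (\<Sum>j=0..n. \<Sum>i=0..n. fps_nth f i * fps_nth (g ^ i) j * fps_nth W (n - j))"
    unfolding fps_mult_nth
  proof (intro sum.cong refl)
    fix j assume "j \<in> {0..n}"
    \<comment> \<open>The series \<open>g ^ i\<close> starts in degree \<open>i\<close>, so the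
      terms with \<open>i > j\<close> vanish and the range can be made independent of
      \<open>j\<close>; then the two sums can be interchanged.\<close>
    then have "fps_nth (f oo g) j = (\<Sum>i=0..n. fps_nth f i * fps_nth (g ^ i) j)"
      unfolding fps_compose_nth
      by (intro sum.mono_neutral_left) (auto simp: g0 startsby_zero_power_prefix)
    then show "fps_nth (f oo g) j * fps_nth W (n - j) =
        (\<Sum>i=0..n. fps_nth f i * fps_nth (g ^ i) j * fps_nth W (n - j))"
      by (simp add: sum_distrib_right)
  qed
  also have "\<dots> = (\<Sum>i=0..n. fps_nth f i * fps_nth (g ^ i * W) n)"
    by (subst sum.swap) (simp add: fps_mult_nth sum_distrib_left mult.assoc)
  also have "\<dots> = (\<Sum>i=0..n. if i = n then fps_nth f i else 0)"
    by (intro sum.cong) (auto simp: coeff)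
  finally show ?thesis
    by (simp add: g_def W_def)
qed

section \<open>Polynomials in \<open>t\<close> expanded at \<open>t = 1\<close> in the parameter
  \<open>z = 1 - t\<close>\<close>

definition expand_at_one :: "'a :: comm_ring_1 poly \<Rightarrow> 'a fps" where
  "expand_at_one p = fps_of_poly (pcompose p [:1, -1:])"

lemma fps_of_poly_1_minus_X: "fps_of_poly [:1, -1 :: 'a :: comm_ring_1:] = 1 - fps_X"
  by (auto simp: fps_eq_iff coeff_pCons split: nat.split)

lemma expand_at_one_mult: "expand_at_one (p * q) = expand_at_one p * expand_at_one q"
  by (simp add: expand_at_one_def pcompose_mult fps_of_poly_mult)

lemma expand_at_one_eq_0_iff [simp]: "expand_at_one (p :: 'a :: idom poly) = 0 \<longleftrightarrow> p = 0"
  by (simp add: expand_at_one_def pcompose_eq_0_iff flip: fps_of_poly_0)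

lemma expand_at_one_altdef:
  "expand_at_one p = (\<Sum>i\<le>degree p. fps_const (coeff p i) * (1 - fps_X) ^ i)"
proof -
  have "pcompose p [:1, -1:] = (\<Sum>i\<le>degree p. smult (coeff p i) ([:1, -1:] ^ i))"
    by (simp add: pcompose_altdef poly_altdef coeff_map_poly degree_map_poly)
  then show ?thesis
    by (simp add: expand_at_one_def fps_of_poly_sum fps_of_poly_smult fps_of_poly_power
        fps_of_poly_1_minus_X)
qed

lemma expand_at_one_1_minus_monom: "expand_at_one (1 - monom 1 e) = 1 - (1 - fps_X) ^ e"
proof -
  have "pcompose ([:0, 1:] ^ e) q = q ^ e" for q :: "'a poly"
    by (induction e) (simp_all add: pcompose_1 pcompose_mult pcompose_pCons)
  then show ?thesis
    by (simp add: expand_at_one_def pcompose_diff pcompose_1 monom_altdef fps_of_poly_diff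
        fps_of_poly_power fps_of_poly_1_minus_X)
qed

lemma expand_at_one_prod_1_minus_monom:
  "expand_at_one (\<Prod>e\<leftarrow>es. 1 - monom 1 e) = (\<Prod>e\<leftarrow>es. 1 - (1 - fps_X) ^ e)"
proof (induction es)
  case Nil
  then show ?case
    by (simp add: expand_at_one_def pcompose_1)
next
  case (Cons e es)
  then show ?case
    by (simp add: expand_at_one_mult expand_at_one_1_minus_monom)
qed

text \<open>Every factor has a simple zero at \<open>z = 0\<close>: its cofactor is a geometric sum
  with constant term \<open>e\<close>, nonzero in characteristic zero. So the denominator vanishes
  to order exactly \<open>length es\<close>, and the factor \<open>z^d\<close> in the definition of
  \<phi> just compensates it.\<close>

lemma prod_1_minus_power_factor:
  fixes es :: "nat list"
  assumes "\<And>e. e \<in> set es \<Longrightarrow> e > 0"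
  shows "\<exists>U :: 'a :: field_char_0 fps. fps_nth U 0 \<noteq> 0 \<and>
    (\<Prod>e\<leftarrow>es. 1 - (1 - fps_X) ^ e) = fps_X ^ length es * U"
  using assms
proof (induction es)
  case Nil
  then show ?case
    by (intro exI[of _ 1]) simp
next
  case (Cons e es)
  then obtain U :: "'a fps" where U: "fps_nth U 0 \<noteq> 0"
    "(\<Prod>e\<leftarrow>es. 1 - (1 - fps_X) ^ e) = fps_X ^ length es * U"
    by force
  define V :: "'a fps" where "V = (\<Sum>i<e. (1 - fps_X) ^ i)"
  have V: "1 - (1 - fps_X) ^ e = fps_X * V"
    by (simp add: one_diff_power_eq V_def)
  have "fps_nth V 0 = of_nat e"
    by (simp add: V_def fps_sum_nth fps_nth_power_0)
  with Cons.prems have "fps_nth V 0 \<noteq> 0"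
    by simp
  with U V show ?case
    by (intro exI[of _ "V * U"]) simp
qed

text \<open>Substituting the inverse \<open>v\<close> of \<open>u\<close> and clearing denominators
  with \<open>u ^ m\<close> reverses the list of coefficients; for a palindromic list nothing
  changes.\<close>

lemma sum_inverse_power_reflect:
  fixes u v :: "'a :: comm_ring_1"
  assumes "u * v = 1"
  shows "u ^ m * (\<Sum>i\<le>m. c i * v ^ i) = (\<Sum>i\<le>m. c (m - i) * u ^ i)"
proof -
  have "u ^ m * (\<Sum>i\<le>m. c i * v ^ i) = (\<Sum>i\<le>m. c i * u ^ (m - i))"
    unfolding sum_distrib_left
  proof (intro sum.cong refl)
    fix i assume "i \<in> {..m}"
    then have "u ^ m * (c i * v ^ i) = c i * u ^ (m - i) * (u ^ i * v ^ i)"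
      using power_add[of u "m - i" i] by (simp add: mult_ac)
    also have "u ^ i * v ^ i = 1"
      by (simp add: assms flip: power_mult_distrib)
    finally show "u ^ m * (c i * v ^ i) = c i * u ^ (m - i)"
      by simp
  qed
  also have "\<dots> = (\<Sum>i\<le>m. c (m - i) * u ^ i)"
    by (rule sum.reindex_bij_witness[of _ "\<lambda>i. m - i" "\<lambda>i. m - i"]) auto
  finally show ?thesis .
qed

text \<open>Factor by factor \<open>u^e (1 - u^(-e)) = -(1 - u^e)\<close>; this is the source of the
  sign \<open>(-1)^d\<close> in the functional equation.\<close>

lemma prod_1_minus_power_reflect:
  fixes u v :: "'a :: comm_ring_1"
  assumes "u * v = 1"
  shows "u ^ sum_list es * (\<Prod>e\<leftarrow>es. 1 - v ^ e) = (- 1) ^ length es * (\<Prod>e\<leftarrow>es. 1 - u ^ e)"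
proof (induction es)
  case (Cons e es)
  have eq: "u ^ e * (1 - v ^ e) = - (1 - u ^ e)"
    using assms by (simp add: right_diff_distrib flip: power_mult_distrib)
  have "u ^ sum_list (e # es) * (\<Prod>e\<leftarrow>e # es. 1 - v ^ e) =
      (u ^ e * (1 - v ^ e)) * (u ^ sum_list es * (\<Prod>e\<leftarrow>es. 1 - v ^ e))"
    by (simp add: power_add mult_ac)
  also have "\<dots> = (- 1) ^ length (e # es) * (\<Prod>e\<leftarrow>e # es. 1 - u ^ e)"
    unfolding Cons.IH eq by (simp add: algebra_simps)
  finally show ?case .
qed simp

lemma fps_compose_prod_1_minus_power:
  fixes g :: "'a :: field fps"
  assumes "fps_nth g 0 = 0"
  shows "(\<Prod>e\<leftarrow>es. 1 - (1 - fps_X) ^ e) oo g = (\<Prod>e\<leftarrow>es. 1 - (1 - g) ^ e)"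
  by (induction es)
     (simp_all add: assms fps_compose_mult_distrib fps_compose_sub_distrib flip: fps_compose_power)

lemma fps_compose_expand_at_one:
  fixes g :: "'a :: field fps"
  assumes "fps_nth g 0 = 0"
  shows "expand_at_one p oo g = (\<Sum>i\<le>degree p. fps_const (coeff p i) * (1 - g) ^ i)"
  by (simp add: expand_at_one_altdef assms fps_compose_mult_distrib fps_compose_sub_distrib
      fps_compose_sum_distrib flip: fps_compose_power)

text \<open>Composing with \<open>z/(1+z)\<close> evaluates the Hilbert series at \<open>1/(1+z)\<close>, composing with \<open>-z\<close>
  evaluates it at \<open>1+z\<close>.\<close>

lemma palindromic_functional_equation:
  fixes \<phi> :: "'a :: field_char_0 fps"
  assumes p: "reflect_poly p = p" "p \<noteq> 0"
    and pos: "\<And>e. e \<in> set es \<Longrightarrow> e > 0"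
    and \<phi>: "\<phi> * (\<Prod>e\<leftarrow>es. 1 - (1 - fps_X) ^ e) = fps_X ^ length es * expand_at_one p"
  shows "\<phi> oo (fps_X / (1 + fps_X)) =
    fps_binomial (of_int (int (sum_list es) - int (degree p) - int (length es))) * (\<phi> oo (- fps_X))"
proof -
  \<comment> \<open>\<open>u\<close> and \<open>v\<close> are the values of \<open>t\<close> after
    the substitutions \<open>-z\<close> and \<open>z/(1+z)\<close>; below, \<open>T\<close> and
    \<open>E\<close> are the denominator and the numerator of the Hilbert series as functions of
    \<open>t\<close>.\<close>
  define u v :: "'a fps" where "u = 1 + fps_X" and "v = fps_binomial (- 1)"
  define d \<sigma> where "d = length es" and "\<sigma> = degree p"
  define T :: "'a fps \<Rightarrow> 'a fps" where "T w = (\<Prod>e\<leftarrow>es. 1 - w ^ e)" for w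
  define E :: "'a fps \<Rightarrow> 'a fps" where "E w = (\<Sum>i\<le>\<sigma>. fps_const (coeff p i) * w ^ i)" for w
  define a b where "a = \<phi> oo (fps_X / (1 + fps_X))" and "b = \<phi> oo (- fps_X)"
  have uv: "u * v = 1"
    by (simp add: u_def v_def flip: fps_binomial_1 fps_binomial_add_mult)
  have g: "fps_X / (1 + fps_X) = fps_X * v"
    by (simp add: fps_X_div_1_plus_X v_def)
  have "1 - fps_X * v = v"
    using uv by (simp add: u_def algebra_simps)
  then have a: "a * T v = (fps_X * v) ^ d * E v"
    using arg_cong[OF \<phi>, of "\<lambda>f. f oo (fps_X * v)"]
    by (simp add: fps_compose_mult_distrib fps_compose_prod_1_minus_power fps_compose_expand_at_one
        g a_def T_def E_def d_def \<sigma>_def flip: fps_compose_power)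
  have b: "b * T u = (- fps_X) ^ d * E u"
    using arg_cong[OF \<phi>, of "\<lambda>f. f oo (- fps_X)"]
    by (simp add: fps_compose_mult_distrib fps_compose_prod_1_minus_power fps_compose_expand_at_one
        u_def b_def T_def E_def d_def \<sigma>_def flip: fps_compose_power)
  have "coeff p (\<sigma> - i) = coeff p i" if "i \<le> \<sigma>" for i
    using that p(1) coeff_reflect_poly[of p i] by (simp add: \<sigma>_def)
  then have E: "u ^ \<sigma> * E v = E u"
    unfolding E_def sum_inverse_power_reflect[OF uv] by (intro sum.cong) auto
  have T: "u ^ sum_list es * T v = (- 1) ^ d * T u"
    unfolding T_def d_def by (rule prod_1_minus_power_reflect[OF uv])
  have ud: "u ^ d * (fps_X * v) ^ d = fps_X ^ d"
    using uv by (simp add: mult_ac flip: power_mult_distrib)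
  \<comment> \<open>Everything is multiplied by \<open>T u\<close>, so no division occurs before the
    final cancellation. The sign produced by reflecting \<open>T\<close> meets the one in
    \<open>(- fps_X) ^ d\<close>.\<close>
  have "(- 1) ^ d * (u ^ (\<sigma> + d) * a) * T u = u ^ (\<sigma> + d) * a * (u ^ sum_list es * T v)"
    unfolding T by (simp only: mult_ac)
  also have "\<dots> = u ^ sum_list es * (u ^ d * (fps_X * v) ^ d) * (u ^ \<sigma> * E v)"
    using a by (simp add: power_add mult_ac)
  also have "\<dots> = u ^ sum_list es * (fps_X ^ d * E u)"
    unfolding ud E by (simp add: mult_ac)
  also have "fps_X ^ d * E u = (- 1) ^ d * (b * T u)"
    unfolding b power_minus[of "fps_X :: 'a fps"] by (simp add: mult.assoc)
  finally have "(- 1) ^ d * (u ^ (\<sigma> + d) * a) * T u = (- 1) ^ d * (u ^ sum_list es * b) * T u"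
    by (simp add: mult_ac)
  moreover have "T u \<noteq> 0"
  proof -
    \<comment> \<open>The coefficient of \<open>z\<close> in \<open>1 - (1+z)^e\<close> is
      \<open>-e\<close>.\<close>
    have "1 - u ^ e \<noteq> 0" if "e \<in> set es" for e
    proof
      assume "1 - u ^ e = 0"
      then have "fps_nth (1 - u ^ e) 1 = 0"
        by simp
      then show False
        using pos[OF that] by (simp add: u_def flip: fps_binomial_of_nat)
    qed
    then show ?thesis
      by (auto simp: T_def prod_list_zero_iff)
  qed
  ultimately have eq: "u ^ (\<sigma> + d) * a = u ^ sum_list es * b"
    by simp
  define B where "B = (fps_binomial (- of_nat (\<sigma> + d)) :: 'a fps)"
  have "B * u ^ (\<sigma> + d) = 1"
    by (simp add: B_def u_def flip: fps_binomial_of_nat fps_binomial_add_mult)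
  then have "a = B * (u ^ sum_list es * b)"
    by (metis eq mult.assoc mult_1)
  also have "B * (u ^ sum_list es * b) = fps_binomial (- of_nat (\<sigma> + d) + of_nat (sum_list es)) * b"
    by (simp only: B_def u_def fps_binomial_add_mult fps_binomial_of_nat mult.assoc)
  also have "(- of_nat (\<sigma> + d) + of_nat (sum_list es) :: 'a) =
      of_int (int (sum_list es) - int \<sigma> - int d)"
    by simp
  finally show ?thesis
    by (simp add: a_def b_def \<sigma>_def d_def)
qed

text \<open>\<open>reflect_poly\<close> reverses about the degree, so the degree must be exactly
  \<sigma>. It is, because the symmetry carries \<open>q 0 \<noteq> 0\<close> to
  \<open>q \<sigma> \<noteq> 0\<close>.\<close>

lemma palindromic_sequence_poly:
  fixes q :: "nat \<Rightarrow> int"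
  assumes above: "\<And>n. n > \<sigma> \<Longrightarrow> q n = 0" and sym: "\<And>i. i \<le> \<sigma> \<Longrightarrow> q i = q (\<sigma> - i)" and q0: "q 0 \<noteq> 0"
  shows "\<exists>p :: 'a :: field_char_0 poly.
    reflect_poly p = p \<and> p \<noteq> 0 \<and> fps_of_poly p = Abs_fps (\<lambda>n. of_int (q n))"
proof -
  define p :: "'a poly" where "p = truncate_fps (Suc \<sigma>) (Abs_fps (\<lambda>n. of_int (q n)))"
  have coeff: "coeff p n = of_int (q n)" for n
    using above[of n] by (simp add: p_def coeff_truncate_fps)
  have "degree p = \<sigma>"
  proof (rule antisym)
    show "degree p \<le> \<sigma>"
      by (intro degree_le) (simp add: coeff above)
    show "\<sigma> \<le> degree p"
      using q0 sym[of \<sigma>] by (intro le_degree) (simp add: coeff)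
  qed
  then have "reflect_poly p = p"
    by (auto simp: poly_eq_iff coeff_reflect_poly coeff above sym[symmetric])
  moreover have "p \<noteq> 0"
    using q0 coeff[of 0] by auto
  moreover have "fps_of_poly p = Abs_fps (\<lambda>n. of_int (q n))"
    by (simp add: fps_eq_iff coeff)
  ultimately show ?thesis
    by blast
qed

section \<open>The \<a>-invariant and \<phi> computed from any one fraction for the Hilbert
  series\<close>

lemma represents_rational_cross:
  assumes "represents_rational H P Q" "represents_rational H P' Q'"
  shows "P * Q' = P' * Q"
proof -
  have "(H * fps_of_poly Q) * fps_of_poly Q' = (H * fps_of_poly Q') * fps_of_poly Q"
    by (simp add: mult_ac)
  then have "fps_of_poly (P * Q') = fps_of_poly (P' * Q)"
    using assms by (simp only: represents_rational_def fps_of_poly_mult)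
  then show ?thesis
    by (simp add: fps_of_poly_eq_iff)
qed

text \<open>Cross-multiplication preserves the difference of degrees as long as no factor is zero.
  Since \<open>degree 0 = 0\<close>, the zero series would admit many differences, which is why
  \<open>P \<noteq> 0\<close> is asked for.\<close>

lemma a_invariant_eq:
  assumes PQ: "represents_rational (hilbert_series R A) P Q" and "P \<noteq> 0"
  shows "a_invariant R A = int (degree P) - int (degree Q)"
  unfolding a_invariant_def
proof (rule the_equality)
  fix a
  assume "\<exists>P Q. represents_rational (hilbert_series R A) P Q \<and> a = int (degree P) - int (degree Q)"
  then obtain P' Q' where PQ': "represents_rational (hilbert_series R A) P' Q'"
    and a: "a = int (degree P') - int (degree Q')"
    by blast
  have eq: "P * Q' = P' * Q"
    using PQ PQ' by (rule represents_rational_cross)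
  moreover have "Q \<noteq> 0" "Q' \<noteq> 0"
    using PQ PQ' by (auto simp: represents_rational_def)
  ultimately have "degree P + degree Q' = degree P' + degree Q"
    using \<open>P \<noteq> 0\<close> by (metis degree_mult_eq mult_eq_0_iff)
  then show "a = int (degree P) - int (degree Q)"
    using a by linarith
qed (use PQ in blast)

text \<open>\<open>expand_at_one Q\<close> may vanish at \<open>z = 0\<close>, but it is a nonzero
  element of the domain of power series and can be cancelled.\<close>

lemma phi_series_eq:
  assumes PQ: "represents_rational (hilbert_series R A) P Q"
    and f: "f * expand_at_one Q = fps_X ^ d * expand_at_one P"
  shows "phi_series R A d = f"
  unfolding phi_series_def expand_at_one_def[symmetric]
proof (rule the_equality)
  fix f'
  assume "\<exists>P Q. represents_rational (hilbert_series R A) P Q \<and>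
    f' * expand_at_one Q = fps_X ^ d * expand_at_one P"
  then obtain P' Q' where PQ': "represents_rational (hilbert_series R A) P' Q'"
    and f': "f' * expand_at_one Q' = fps_X ^ d * expand_at_one P'"
    by blast
  have "expand_at_one (P * Q') = expand_at_one (P' * Q)"
    using represents_rational_cross[OF PQ PQ'] by simp
  then have "(f' * expand_at_one Q') * expand_at_one Q = (f * expand_at_one Q) * expand_at_one Q'"
    unfolding f f' by (simp add: expand_at_one_mult mult_ac)
  moreover have "expand_at_one Q \<noteq> 0" "expand_at_one Q' \<noteq> 0"
    using PQ PQ' by (auto simp: represents_rational_def)
  ultimately show "f' = f"
    by (simp add: mult_ac)
qed (use assms in blast)

text \<open>All commutative algebra is condensed into the hypothesis that the Hilbert series times
  the product is a palindromic polynomial. Then \<open>a\<close> is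
  \<open>degree p - sum_list es\<close>, so the exponent in the functional equation is
  \<open>s\<close>.\<close>

lemma coeff_mult_phi_series:
  assumes H: "hilbert_series R A * (\<Prod>e\<leftarrow>es. 1 - fps_X ^ e) = fps_of_poly p"
    and p: "reflect_poly p = p" "p \<noteq> 0"
    and pos: "\<And>e. e \<in> set es \<Longrightarrow> e > 0"
    and s: "s = - (a_invariant R A + int (length es))"
    and \<phi>: "\<phi> = phi_series R A (length es)"
  shows "fps_nth (h * \<phi>) n =
    fps_nth (fps_compose h (fps_X / (1 + fps_X)) * (1 + fps_X) powi (int n - 1 + s)
      * fps_compose \<phi> (- fps_X)) n"
proof -
  define Q :: "complex poly" where "Q = (\<Prod>e\<leftarrow>es. 1 - monom 1 e)"
  have deg: "degree (1 - monom 1 e :: complex poly) = e" "1 - monom 1 e \<noteq> (0 :: complex poly)"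
    if "e > 0" for e
  proof -
    show "degree (1 - monom 1 e :: complex poly) = e"
      using that degree_add_eq_right[of 1 "- monom 1 e :: complex poly"]
      by (simp add: degree_monom_eq)
    with that show "1 - monom 1 e \<noteq> (0 :: complex poly)"
      by auto
  qed
  have Q0: "Q \<noteq> 0"
    using deg(2) pos by (auto simp: Q_def prod_list_zero_iff)
  have degQ: "degree Q = sum_list es"
    using pos unfolding Q_def
  proof (induction es)
    case (Cons e es)
    moreover from Cons have "(\<Prod>e\<leftarrow>es. 1 - monom 1 e) \<noteq> (0 :: complex poly)"
      using deg(2) by (auto simp: prod_list_zero_iff)
    ultimately show ?case
      using deg by (simp add: degree_mult_eq)
  qed simp
  have "fps_of_poly Q = (\<Prod>e\<leftarrow>es. 1 - fps_X ^ e)"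
    unfolding Q_def fps_of_poly_prod_list
    by (simp add: o_def fps_of_poly_diff fps_of_poly_monom')
  with H Q0 have PQ: "represents_rational (hilbert_series R A) p Q"
    by (simp add: represents_rational_def)
  obtain U :: "complex fps" where U: "fps_nth U 0 \<noteq> 0"
    "(\<Prod>e\<leftarrow>es. 1 - (1 - fps_X) ^ e) = fps_X ^ length es * U"
    using prod_1_minus_power_factor[of es] pos by blast
  have EQ: "expand_at_one Q = (\<Prod>e\<leftarrow>es. 1 - (1 - fps_X) ^ e)"
    by (simp add: Q_def expand_at_one_prod_1_minus_monom)
  \<comment> \<open>\<open>U\<close> is the unit left after removing \<open>z^d\<close> from the
    denominator, so \<phi> is \<open>p(1-z)/U\<close>.\<close>
  have f: "(expand_at_one p * inverse U) * expand_at_one Q = fps_X ^ length es * expand_at_one p"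
    using inverse_mult_eq_1[OF U(1)] unfolding EQ U(2) by (simp add: mult_ac)
  then have "\<phi> * expand_at_one Q = fps_X ^ length es * expand_at_one p"
    unfolding \<phi> phi_series_eq[OF PQ f] .
  then have "\<phi> oo (fps_X / (1 + fps_X)) =
      fps_binomial (of_int (int (sum_list es) - int (degree p) - int (length es))) * (\<phi> oo (- fps_X))"
    unfolding EQ by (intro palindromic_functional_equation p pos)
  also have "int (sum_list es) - int (degree p) - int (length es) = s"
    by (simp add: s a_invariant_eq[OF PQ p(2)] degQ)
  finally have \<phi>_eq: "\<phi> oo (fps_X / (1 + fps_X)) = fps_binomial (of_int s) * (\<phi> oo (- fps_X))" .
  \<comment> \<open>The residue identity is applied to the product; composition is multiplicative,
    and the exponents \<open>n - 1\<close> and \<open>s\<close> add up.\<close>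
  have "fps_nth (h * \<phi>) n =
      fps_nth ((h * \<phi> oo (fps_X / (1 + fps_X))) * fps_binomial (of_int (int n - 1))) n"
    by (rule coeff_fps_compose_X_div_1_plus_X[symmetric])
  also have "(h * \<phi> oo (fps_X / (1 + fps_X))) * fps_binomial (of_int (int n - 1)) =
      (h oo (fps_X / (1 + fps_X))) * (fps_binomial (of_int (int n - 1)) * fps_binomial (of_int s)) *
      (\<phi> oo (- fps_X))"
    by (subst fps_compose_mult_distrib) (simp add: fps_X_div_1_plus_X, simp only: \<phi>_eq mult_ac)
  also have "fps_binomial (of_int (int n - 1)) * fps_binomial (of_int s) =
      ((1 + fps_X) powi (int n - 1 + s) :: complex fps)"
    by (simp flip: fps_binomial_of_int fps_binomial_add_mult)
  finally show ?thesis .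
qed

subsection \<open>Chains of primes and regular sequences\<close>

text \<open>An ideal maximal among those missing a multiplicative set is prime: if \<open>a\<close>
  and \<open>b\<close> lie outside \<open>M\<close>, then \<open>M + (a)\<close> and
  \<open>M + (b)\<close> both meet \<open>S\<close>, and the product of the two elements found lies
  in \<open>M + (ab)\<close>.\<close>

lemma (in cring) exists_primeideal_disjoint:
  assumes I: "ideal I R" and S: "S \<subseteq> carrier R" "\<one> \<in> S"
    and mult: "\<And>x y. x \<in> S \<Longrightarrow> y \<in> S \<Longrightarrow> x \<otimes> y \<in> S"
    and disj: "I \<inter> S = {}"
  shows "\<exists>P. primeideal P R \<and> I \<subseteq> P \<and> P \<inter> S = {}"
proof -
  define D where "D = {J. ideal J R \<and> I \<subseteq> J \<and> J \<inter> S = {}}"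
  have "\<exists>M\<in>D. \<forall>J\<in>D. M \<subseteq> J \<longrightarrow> J = M"
  proof (rule subset_Zorn_nonempty)
    show "D \<noteq> {}"
      using I disj by (auto simp: D_def)
  next
    fix C assume C: "C \<noteq> {}" "subset.chain D C"
    then have sub: "C \<subseteq> D" and total: "\<And>J L. J \<in> C \<Longrightarrow> L \<in> C \<Longrightarrow> J \<subseteq> L \<or> L \<subseteq> J"
      by (auto simp: subset.chain_def)
    have ideals: "ideal J R" if "J \<in> C" for J
      using that sub by (auto simp: D_def)
    note sg = ideals[THEN ideal.axioms(1)]
    have "ideal (\<Union>C) R"
    proof (rule idealI[OF ring_axioms])
      show "subgroup (\<Union>C) (add_monoid R)"
      proof (rule add.subgroupI)
        show "\<Union>C \<subseteq> carrier R"
          using ideal.Icarr[OF ideals] by blast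
        show "\<Union>C \<noteq> {}"
          using C(1) additive_subgroup.zero_closed[OF sg] by blast
        show "\<ominus> a \<in> \<Union>C" if "a \<in> \<Union>C" for a
          using that additive_subgroup.a_inv_closed[OF sg] by blast
        show "a \<oplus> b \<in> \<Union>C" if ab: "a \<in> \<Union>C" "b \<in> \<Union>C" for a b
        proof -
          obtain J L where "J \<in> C" "L \<in> C" "a \<in> J" "b \<in> L"
            using ab by blast
          then obtain Z where "Z \<in> C" "a \<in> Z" "b \<in> Z"
            using total[of J L] by auto
          then show ?thesis
            using additive_subgroup.a_closed[OF sg] by blast
        qed
      qed
      show "x \<otimes> a \<in> \<Union>C" "a \<otimes> x \<in> \<Union>C" if "a \<in> \<Union>C" "x \<in> carrier R" for a x
        using that ideal.I_l_closed[OF ideals] ideal.I_r_closed[OF ideals] by blast+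
    qed
    then show "\<Union>C \<in> D"
      using C(1) sub by (auto simp: D_def)
  qed
  then obtain M where M: "ideal M R" "I \<subseteq> M" "M \<inter> S = {}"
    and max: "\<And>J. ideal J R \<Longrightarrow> M \<subseteq> J \<Longrightarrow> J \<inter> S = {} \<Longrightarrow> J = M"
    unfolding D_def by (smt (verit) mem_Collect_eq order_trans)
  interpret M: ideal M R by fact
  have meets: "\<exists>m\<in>M. \<exists>r\<in>carrier R. m \<oplus> r \<otimes> a \<in> S" if a: "a \<in> carrier R" "a \<notin> M" for a
  proof -
    have "ideal (M <+>\<^bsub>R\<^esub> PIdl a) R"
      by (intro add_ideals M cgenideal_ideal a)
    moreover have "M \<subseteq> M <+>\<^bsub>R\<^esub> PIdl a"
    proof
      fix m assume "m \<in> M"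
      moreover have "m = m \<oplus> \<zero>" "\<zero> \<in> PIdl a"
        using \<open>m \<in> M\<close> M.Icarr additive_subgroup.zero_closed[OF ideal.axioms(1)[OF cgenideal_ideal[OF a(1)]]]
        by auto
      ultimately show "m \<in> M <+>\<^bsub>R\<^esub> PIdl a"
        unfolding set_add_def' by blast
    qed
    moreover have "a = \<zero> \<oplus> a" "a \<in> PIdl a"
      using a cgenideal_self by auto
    then have "a \<in> M <+>\<^bsub>R\<^esub> PIdl a"
      using M.zero_closed unfolding set_add_def' by blast
    ultimately have "(M <+>\<^bsub>R\<^esub> PIdl a) \<inter> S \<noteq> {}"
      using max a(2) by blast
    then show ?thesis
      unfolding set_add_def' cgenideal_def by blast
  qed
  have "primeideal M R"
  proof (rule primeidealI)
    show "carrier R \<noteq> M"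
      using M(3) S by auto
  next
    fix a b assume ab: "a \<in> carrier R" "b \<in> carrier R" "a \<otimes> b \<in> M"
    show "a \<in> M \<or> b \<in> M"
    proof (rule ccontr)
      assume "\<not> ?thesis"
      then obtain m r m' r' where mr: "m \<in> M" "r \<in> carrier R" "m \<oplus> r \<otimes> a \<in> S"
        "m' \<in> M" "r' \<in> carrier R" "m' \<oplus> r' \<otimes> b \<in> S"
        using meets ab by metis
      then have "(m \<oplus> r \<otimes> a) \<otimes> (m' \<oplus> r' \<otimes> b) \<in> S"
        by (intro mult)
      moreover have "(m \<oplus> r \<otimes> a) \<otimes> (m' \<oplus> r' \<otimes> b) =
          m \<otimes> (m' \<oplus> r' \<otimes> b) \<oplus> ((r \<otimes> a) \<otimes> m' \<oplus> (r \<otimes> r') \<otimes> (a \<otimes> b))"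
        using mr ab M.Icarr[OF mr(1)] M.Icarr[OF mr(4)] by algebra
      moreover have "\<dots> \<in> M"
        using mr ab M.Icarr[OF mr(1)] M.Icarr[OF mr(4)]
        by (intro M.a_closed M.I_r_closed[OF mr(1)] M.I_l_closed[OF mr(4)] M.I_l_closed[OF ab(3)]) auto
      ultimately show False
        using M(3) by auto
    qed
  qed (rule M(1), rule is_cring)
  with M show ?thesis
    by blast
qed

text \<open>The prime produced avoids the multiplicative set generated by \<open>a\<close> and the complement of \<open>P\<close>.\<close>

lemma (in cring) exists_primeideal_below:
  assumes P: "primeideal P R" and I: "ideal I R" "I \<subseteq> P" and a: "a \<in> P"
    and nzd: "\<And>(n::nat) s. s \<in> carrier R \<Longrightarrow> a [^] n \<otimes> s \<in> I \<Longrightarrow> s \<in> P"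
  shows "\<exists>P'. primeideal P' R \<and> I \<subseteq> P' \<and> P' \<subset> P"
proof -
  interpret P: primeideal P R by fact
  have ac: "a \<in> carrier R"
    using a P.Icarr by simp
  \<comment> \<open>Exponent \<open>0\<close> puts the complement of \<open>P\<close> into
    \<open>S\<close>, so the prime obtained lies in \<open>P\<close>; exponent \<open>1\<close> with
    \<open>s = \<one>\<close> puts \<open>a\<close> into \<open>S\<close>, so the inclusion is
    strict.\<close>
  define S where "S = {a [^] n \<otimes> s | (n::nat) s. s \<in> carrier R \<and> s \<notin> P}"
  have one: "\<one> \<notin> P"
    using P.I_notcarr P.one_imp_carrier by blast
  have mem: "a [^] n \<otimes> s \<in> S" if "s \<in> carrier R" "s \<notin> P" for n :: nat and s
    using that by (auto simp: S_def)
  have "\<exists>P'. primeideal P' R \<and> I \<subseteq> P' \<and> P' \<inter> S = {}"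
  proof (rule exists_primeideal_disjoint[OF I(1)])
    show "S \<subseteq> carrier R"
      using ac by (auto simp: S_def)
    show "\<one> \<in> S"
      using mem[of \<one> 0] one by simp
    show "I \<inter> S = {}"
      using nzd by (auto simp: S_def)
  next
    fix x y assume "x \<in> S" "y \<in> S"
    then obtain n s n' s' where ns: "x = a [^] (n::nat) \<otimes> s" "s \<in> carrier R" "s \<notin> P"
      "y = a [^] (n'::nat) \<otimes> s'" "s' \<in> carrier R" "s' \<notin> P"
      by (auto simp: S_def)
    have "x \<otimes> y = a [^] (n + n') \<otimes> (s \<otimes> s')"
    proof -
      have "x \<otimes> y = (a [^] n \<otimes> a [^] n') \<otimes> (s \<otimes> s')"
        using ns ac by (simp add: m_ac)
      then show ?thesis
        using ac by (simp add: nat_pow_mult)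
    qed
    moreover have "s \<otimes> s' \<notin> P"
      using ns P.I_prime by blast
    ultimately show "x \<otimes> y \<in> S"
      using mem ns by simp
  qed
  then obtain P' where P': "primeideal P' R" "I \<subseteq> P'" "P' \<inter> S = {}"
    by blast
  have "P' \<subseteq> P"
  proof
    fix x assume "x \<in> P'"
    moreover from this have "x \<in> carrier R"
      by (rule ideal.Icarr[OF primeideal.axioms(1)[OF P'(1)]])
    ultimately show "x \<in> P"
      using mem[of x 0] P'(3) by auto
  qed
  moreover have "a \<notin> P'"
    using mem[OF one_closed one, of 1] P'(3) ac by auto
  ultimately show ?thesis
    using P' a by blast
qed

lemma (in cring) genideal_insert_mem:
  assumes S: "S \<subseteq> carrier R" and t: "t \<in> carrier R"
  shows "x \<in> genideal R (insert t S) \<longleftrightarrow> (\<exists>i\<in>genideal R S. \<exists>r\<in>carrier R. x = i \<oplus> t \<otimes> r)"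
proof -
  have "genideal R (insert t S) = genideal R S <+>\<^bsub>R\<^esub> PIdl t"
  proof (rule equalityI)
    interpret J: ideal "genideal R S" R
      by (rule genideal_ideal[OF S])
    interpret T: ideal "PIdl t" R
      by (rule cgenideal_ideal[OF t])
    have "x \<in> genideal R S <+>\<^bsub>R\<^esub> PIdl t" if "x \<in> genideal R S" for x
      using that r_zero[OF J.Icarr[OF that], symmetric] T.zero_closed unfolding set_add_def' by blast
    moreover have "t \<in> genideal R S <+>\<^bsub>R\<^esub> PIdl t"
      using l_zero[OF t, symmetric] J.zero_closed cgenideal_self[OF t] unfolding set_add_def' by blast
    ultimately show "genideal R (insert t S) \<subseteq> genideal R S <+>\<^bsub>R\<^esub> PIdl t"
      using genideal_self[OF S] by (intro genideal_minimal add_ideals genideal_ideal cgenideal_ideal S t) auto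
  next
    interpret I: ideal "genideal R (insert t S)" R
      using S t by (intro genideal_ideal) auto
    have ins: "insert t S \<subseteq> genideal R (insert t S)"
      using S t by (intro genideal_self) auto
    have "genideal R S \<subseteq> genideal R (insert t S)" "PIdl t \<subseteq> genideal R (insert t S)"
      using ins genideal_minimal[OF I.is_ideal] cgenideal_minimal[OF I.is_ideal] by simp_all
    then show "genideal R S <+>\<^bsub>R\<^esub> PIdl t \<subseteq> genideal R (insert t S)"
      unfolding set_add_def' using I.a_closed by blast
  qed
  then show ?thesis
    using t unfolding set_add_def' cgenideal_def by (auto simp: m_comm)
qed

text \<open>This bounds the height of \<open>P\<close> from below. The last member of the sequence,
  and hence each of its powers, is a nonzerodivisor modulo the ideal \<open>I\<close> of the others,
  so some prime over \<open>I\<close> lies strictly below \<open>P\<close>. The induction continues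
  from that prime, and therefore \<open>P\<close> has to vary.\<close>

lemma (in cring) prime_chain_below_regular_sequence:
  assumes \<theta>: "set \<theta> \<subseteq> carrier R"
    and nzd: "\<And>i x. i < length \<theta> \<Longrightarrow> x \<in> carrier R \<Longrightarrow>
      (\<theta> ! i) \<otimes> x \<in> genideal R (set (take i \<theta>)) \<Longrightarrow> x \<in> genideal R (set (take i \<theta>))"
    and P: "primeideal P R" "set \<theta> \<subseteq> P"
  shows "\<exists>p :: nat \<Rightarrow> 'a set. p (length \<theta>) = P \<and> (\<forall>i\<le>length \<theta>. primeideal (p i) R) \<and>
    (\<forall>i<length \<theta>. p i \<subset> p (Suc i))"
  using assms
proof (induction \<theta> arbitrary: P rule: rev_induct)
  case Nil
  then show ?case
    by (intro exI[of _ "\<lambda>_. P"]) simp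
next
  case (snoc t \<theta>)
  define I where "I = genideal R (set \<theta>)"
  have \<theta>: "set \<theta> \<subseteq> carrier R" and t: "t \<in> carrier R" "t \<in> P"
    using snoc.prems by auto
  have I: "ideal I R" "I \<subseteq> P"
    unfolding I_def using snoc.prems(4) genideal_ideal[OF \<theta>]
      genideal_minimal[OF primeideal.axioms(1)[OF snoc.prems(3)]] by simp_all
  have t_nzd: "x \<in> I" if "x \<in> carrier R" "t \<otimes> x \<in> I" for x
    using snoc.prems(2)[of "length \<theta>" x] that by (simp add: I_def)
  have "s \<in> I" if "s \<in> carrier R" "t [^] n \<otimes> s \<in> I" for n :: nat and s
    using that
  proof (induction n)
    case (Suc n)
    have "t [^] Suc n \<otimes> s = t \<otimes> (t [^] n \<otimes> s)"
      using t(1) Suc.prems(1) by (simp add: m_ac)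
    with Suc show ?case
      using t_nzd[of "t [^] n \<otimes> s"] t(1) by simp
  qed simp
  then obtain P' where P': "primeideal P' R" "I \<subseteq> P'" "P' \<subset> P"
    using exists_primeideal_below[OF snoc.prems(3) I t(2)] I(2) by blast
  have "set \<theta> \<subseteq> P'"
    using genideal_self[OF \<theta>] P'(2) by (auto simp: I_def)
  moreover have "x \<in> genideal R (set (take i \<theta>))"
    if "i < length \<theta>" "x \<in> carrier R" "(\<theta> ! i) \<otimes> x \<in> genideal R (set (take i \<theta>))" for i x
    using snoc.prems(2)[of i x] that by (simp add: nth_append)
  ultimately obtain p where p: "p (length \<theta>) = P'" "\<forall>i\<le>length \<theta>. primeideal (p i) R"
    "\<forall>i<length \<theta>. p i \<subset> p (Suc i)"
    using snoc.IH[OF \<theta> _ P'(1)] by blast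
  have "\<forall>i\<le>length (\<theta> @ [t]). primeideal ((p(Suc (length \<theta>) := P)) i) R"
    using p(2) snoc.prems(3) by auto
  moreover have "\<forall>i<length (\<theta> @ [t]). (p(Suc (length \<theta>) := P)) i \<subset> (p(Suc (length \<theta>) := P)) (Suc i)"
    using p(1,3) P'(3) by (auto simp: less_Suc_eq)
  ultimately show ?case
    by (intro exI[of _ "p(Suc (length \<theta>) := P)"]) simp
qed

subsection \<open>Homogeneous components and homogeneous ideals\<close>

lemma (in ideal) finsum_mem:
  assumes "finite S" "\<And>i. i \<in> S \<Longrightarrow> f i \<in> I"
  shows "finsum R f S \<in> I"
  using assms
proof (induction S)
  case (insert i S)
  then show ?case
    by (subst finsum_insert) auto
qed simp

context positively_graded_domain
begin

definition component :: "'a \<Rightarrow> nat \<Rightarrow> 'a" where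
  "component x = (THE f. (\<forall>i. f i \<in> A i) \<and> finite {i. f i \<noteq> \<zero>} \<and> x = (\<Oplus>i\<in>{i. f i \<noteq> \<zero>}. f i))"

definition homogeneous_ideal :: "'a set \<Rightarrow> bool" where
  "homogeneous_ideal I \<longleftrightarrow> ideal I R \<and> (\<forall>x\<in>I. \<forall>i. component x i \<in> I)"

lemma homogeneous_carrier: "x \<in> A i \<Longrightarrow> x \<in> carrier R"
  using additive_subgroup.a_subset[OF additive] by blast

lemma
  assumes "x \<in> carrier R"
  shows component_homogeneous: "component x i \<in> A i"
    and finite_support: "finite {i. component x i \<noteq> \<zero>}"
    and component_finsum: "x = (\<Oplus>i\<in>{i. component x i \<noteq> \<zero>}. component x i)"
  using theI'[OF direct_sum[OF assms]] unfolding component_def by blast+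

lemma component_carrier [simp, intro]: "x \<in> carrier R \<Longrightarrow> component x i \<in> carrier R"
  using component_homogeneous homogeneous_carrier by blast

lemma zero_homogeneous [simp]: "\<zero> \<in> A i"
  using additive_subgroup.zero_closed[OF additive] .

lemma add_homogeneous: "x \<in> A i \<Longrightarrow> y \<in> A i \<Longrightarrow> x \<oplus> y \<in> A i"
  using additive_subgroup.a_closed[OF additive] .

lemma minus_homogeneous: "x \<in> A i \<Longrightarrow> \<ominus> x \<in> A i"
  using additive_subgroup.a_inv_closed[OF additive] .

lemma one_homogeneous [simp]: "\<one> \<in> A 0"
  using subringE(3)[OF subfieldE(1)[OF ground_field]] .

text \<open>Components are always computed this way: write the element as a finite sum with one term
  per degree and read the term off.\<close>

lemma component_unique:
  assumes S: "finite S" and f: "\<And>i. i \<in> S \<Longrightarrow> f i \<in> A i"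
  shows "component (\<Oplus>i\<in>S. f i) j = (if j \<in> S then f j else \<zero>)"
proof -
  define g where "g i = (if i \<in> S then f i else \<zero>)" for i
  have fc: "f \<in> S \<rightarrow> carrier R"
    using f homogeneous_carrier by blast
  have g: "g i \<in> A i" for i
    using f by (simp add: g_def)
  have sub: "{i. g i \<noteq> \<zero>} \<subseteq> S"
    by (auto simp: g_def)
  have "(\<Oplus>i\<in>{i. g i \<noteq> \<zero>}. g i) = (\<Oplus>i\<in>S. f i)"
    by (rule add.finprod_mono_neutral_cong_left[OF S sub]) (use fc in \<open>auto simp: g_def\<close>)
  moreover have "(\<Oplus>i\<in>S. f i) \<in> carrier R"
    using fc by (rule finsum_closed)
  ultimately have "component (\<Oplus>i\<in>S. f i) = g"
    unfolding component_def using g sub S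
    by (intro the1_equality direct_sum) (auto intro: finite_subset)
  then show ?thesis
    by (simp add: g_def)
qed

lemma component_finsum_superset:
  assumes "x \<in> carrier R" "finite S" "{i. component x i \<noteq> \<zero>} \<subseteq> S"
  shows "x = (\<Oplus>i\<in>S. component x i)"
proof -
  have "(\<Oplus>i\<in>{i. component x i \<noteq> \<zero>}. component x i) = (\<Oplus>i\<in>S. component x i)"
    using assms by (intro add.finprod_mono_neutral_cong_left) auto
  with component_finsum[OF assms(1)] show ?thesis
    by simp
qed

lemma component_of_homogeneous:
  assumes "x \<in> A i"
  shows "component x j = (if j = i then x else \<zero>)"
  using component_unique[of "{i}" "\<lambda>_. x" j] assms homogeneous_carrier by simp

lemma component_add:
  assumes x: "x \<in> carrier R" and y: "y \<in> carrier R"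
  shows "component (x \<oplus> y) j = component x j \<oplus> component y j"
proof -
  define S where "S = insert j ({i. component x i \<noteq> \<zero>} \<union> {i. component y i \<noteq> \<zero>})"
  have S: "finite S"
    using finite_support x y by (simp add: S_def)
  have "x = (\<Oplus>i\<in>S. component x i)" "y = (\<Oplus>i\<in>S. component y i)"
    by (intro component_finsum_superset x y S; auto simp: S_def)+
  then have "x \<oplus> y = (\<Oplus>i\<in>S. component x i) \<oplus> (\<Oplus>i\<in>S. component y i)"
    by (rule arg_cong2[where f = "(\<oplus>)"])
  also have "\<dots> = (\<Oplus>i\<in>S. component x i \<oplus> component y i)"
    using x y by (intro finsum_addf[symmetric]) auto
  also have "component \<dots> j = component x j \<oplus> component y j"
    using S x y by (subst component_unique) (auto simp: S_def intro: add_homogeneous component_homogeneous)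
  finally show ?thesis .
qed

lemma component_zero [simp]: "component \<zero> j = \<zero>"
  using component_of_homogeneous[OF zero_homogeneous, of j j] by auto

lemma component_mult:
  assumes a: "a \<in> A e" and x: "x \<in> carrier R"
  shows "component (a \<otimes> x) j = (if e \<le> j then a \<otimes> component x (j - e) else \<zero>)"
proof -
  define S where "S = insert (j - e) {i. component x i \<noteq> \<zero>}"
  have S: "finite S"
    using finite_support x by (simp add: S_def)
  have ac: "a \<in> carrier R"
    using a homogeneous_carrier by blast
  have "x = (\<Oplus>i\<in>S. component x i)"
    by (intro component_finsum_superset x S) (auto simp: S_def)
  then have "a \<otimes> x = a \<otimes> (\<Oplus>i\<in>S. component x i)"
    by (rule arg_cong)
  also have "\<dots> = (\<Oplus>i\<in>S. a \<otimes> component x i)"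
    using x ac S by (intro finsum_rdistr) auto
  also have "\<dots> = (\<Oplus>i\<in>S. a \<otimes> component x ((e + i) - e))"
    by simp
  also have "\<dots> = (\<Oplus>i\<in>(+) e ` S. a \<otimes> component x (i - e))"
    using x ac by (intro finsum_reindex[symmetric]) auto
  also have "component \<dots> j = (if j \<in> (+) e ` S then a \<otimes> component x (j - e) else \<zero>)"
    using S x a mult_degree[OF a component_homogeneous[OF x]] by (intro component_unique) auto
  also have "\<dots> = (if e \<le> j then a \<otimes> component x (j - e) else \<zero>)"
  proof -
    have "j \<in> (+) e ` S \<longleftrightarrow> e \<le> j"
    proof
      assume "e \<le> j"
      then have "j = e + (j - e)" "j - e \<in> S"
        by (auto simp: S_def)
      then show "j \<in> (+) e ` S"
        by blast
    qed auto
    then show ?thesis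
      by simp
  qed
  finally show ?thesis .
qed

lemma carrier_homogeneous_induct [consumes 1, case_names homogeneous add]:
  assumes "x \<in> carrier R"
    and hom: "\<And>i x. x \<in> A i \<Longrightarrow> P x"
    and add: "\<And>x y. x \<in> carrier R \<Longrightarrow> y \<in> carrier R \<Longrightarrow> P x \<Longrightarrow> P y \<Longrightarrow> P (x \<oplus> y)"
  shows "P x"
proof -
  have "P (\<Oplus>i\<in>S. component x i)" if "finite S" for S
    using that
  proof (induction S)
    case empty
    then show ?case
      using hom[OF zero_homogeneous] by simp
  next
    case (insert i S)
    then show ?case
      using assms(1) hom[OF component_homogeneous[OF assms(1)]]
      by (subst finsum_insert) (auto intro!: add finsum_closed)
  qed
  then show ?thesis
    using component_finsum[OF assms(1)] finite_support[OF assms(1)] by metis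
qed

text \<open>The elements all of whose components lie in the generated ideal form an ideal
  \<open>J\<close> themselves, and \<open>J\<close> contains \<open>S\<close>; minimality does the
  rest. That \<open>J\<close> absorbs multiplication is seen for homogeneous multipliers, which
  shift components, and extended additively.\<close>

lemma homogeneous_ideal_genideal:
  assumes S: "S \<subseteq> (\<Union>i. A i)"
  shows "homogeneous_ideal (genideal R S)"
proof -
  have Sc: "S \<subseteq> carrier R"
    using S homogeneous_carrier by blast
  interpret I: ideal "genideal R S" R
    by (rule genideal_ideal[OF Sc])
  define J where "J = {x \<in> carrier R. \<forall>i. component x i \<in> genideal R S}"
  have J0: "\<zero> \<in> J"
    by (simp add: J_def)
  have Jadd: "x \<oplus> y \<in> J" if "x \<in> J" "y \<in> J" for x y
    using that by (simp add: J_def component_add)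
  have Jmult: "r \<otimes> x \<in> J" if "x \<in> J" "r \<in> carrier R" for x r
    using that(2)
  proof (induction rule: carrier_homogeneous_induct)
    case (homogeneous i r)
    then show ?case
      using that(1) homogeneous_carrier I.I_l_closed by (simp add: J_def component_mult)
  next
    case (add r r')
    then show ?case
      using that(1) Jadd by (simp add: J_def l_distr)
  qed
  have "ideal J R"
  proof (rule idealI[OF ring_axioms])
    show "subgroup J (add_monoid R)"
    proof (rule add.subgroupI)
      show "\<ominus> x \<in> J" if "x \<in> J" for x
        using Jmult[OF that, of "\<ominus> \<one>"] that by (simp add: J_def l_minus)
    qed (use J0 Jadd in \<open>auto simp: J_def\<close>)
    show "x \<otimes> a \<in> J" "a \<otimes> x \<in> J" if "a \<in> J" "x \<in> carrier R" for a x
      using Jmult[OF that] that by (auto simp: m_comm J_def)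
  qed
  moreover have "S \<subseteq> J"
  proof
    fix x assume x: "x \<in> S"
    then obtain i where "x \<in> A i"
      using S by blast
    then show "x \<in> J"
      using x genideal_self[OF Sc] Sc by (auto simp: J_def component_of_homogeneous)
  qed
  ultimately have "genideal R S \<subseteq> J"
    by (rule genideal_minimal)
  then show ?thesis
    using I.is_ideal by (auto simp: homogeneous_ideal_def J_def)
qed

text \<open>Take the component of degree \<open>n\<close> in \<open>x = y + t r\<close>. For
  \<open>e > n\<close> the second term contributes nothing, and the disjunction keeps the truncated
  difference \<open>n - e\<close> out of that case.\<close>

lemma homogeneous_mem_genideal_insert:
  assumes S: "S \<subseteq> (\<Union>i. A i)" and t: "t \<in> A e"
    and x: "x \<in> A n" "x \<in> genideal R (insert t S)"
  shows "\<exists>y\<in>genideal R S \<inter> A n. x = y \<or> e \<le> n \<and> (\<exists>r\<in>A (n - e). x = y \<oplus> t \<otimes> r)"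
proof -
  have Sc: "S \<subseteq> carrier R" and tc: "t \<in> carrier R"
    using S t homogeneous_carrier by blast+
  obtain y r where y: "y \<in> genideal R S" and r: "r \<in> carrier R" and eq: "x = y \<oplus> t \<otimes> r"
    using x(2) unfolding genideal_insert_mem[OF Sc tc] by blast
  have yc: "y \<in> carrier R"
    using ideal.Icarr[OF genideal_ideal[OF Sc] y] .
  have "component y n \<in> genideal R S \<inter> A n"
    using homogeneous_ideal_genideal[OF S] y component_homogeneous[OF yc]
    by (simp add: homogeneous_ideal_def)
  moreover have "x = component y n \<oplus> component (t \<otimes> r) n"
    using component_of_homogeneous[OF x(1), of n] eq yc tc r by (simp add: component_add)
  moreover have "component r (n - e) \<in> A (n - e)"
    by (rule component_homogeneous[OF r])
  ultimately show ?thesis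
    using component_mult[OF t r, of n] yc by (auto split: if_splits)
qed

text \<open>\<open>G\<close> collects the nonzero components of positive degree of the algebra
  generators. The sum of \<open>A 0\<close> and the ideal of \<open>G\<close> is a subring
  containing all generators, hence is \<open>R\<close>; comparing components in degree
  \<open>n > 0\<close> removes the part in \<open>A 0\<close>.\<close>

lemma finitely_generated_homogeneous:
  "\<exists>G. finite G \<and> (\<forall>g\<in>G. g \<noteq> \<zero> \<and> (\<exists>i>0. g \<in> A i)) \<and> (\<forall>n>0. A n \<subseteq> genideal R G)"
proof -
  obtain S where S: "finite S" "S \<subseteq> carrier R" "generate_ring R (A 0 \<union> S) = carrier R"
    using finitely_generated by blast
  define G where "G = (\<Union>s\<in>S. component s ` {i. i > 0 \<and> component s i \<noteq> \<zero>})"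
  have fin: "finite G"
    unfolding G_def using S(1,2)
    by (intro finite_UN_I finite_imageI finite_subset[OF _ finite_support]) auto
  have G: "\<forall>g\<in>G. g \<noteq> \<zero> \<and> (\<exists>i>0. g \<in> A i)"
    using S(2) component_homogeneous by (auto simp: G_def)
  then have Gh: "G \<subseteq> (\<Union>i. A i)"
    by blast
  then have Gc: "G \<subseteq> carrier R"
    by (auto dest: homogeneous_carrier)
  interpret I: ideal "genideal R G" R
    by (rule genideal_ideal[OF Gc])
  have K: "subring (A 0) R"
    by (rule subfieldE(1)[OF ground_field])
  define T where "T = {k \<oplus> y | k y. k \<in> A 0 \<and> y \<in> genideal R G}"
  have memT: "k \<oplus> y \<in> T" if "k \<in> A 0" "y \<in> genideal R G" for k y
    using that by (auto simp: T_def)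
  have KT: "k \<in> T" if "k \<in> A 0" for k
    using memT[OF that I.zero_closed] homogeneous_carrier[OF that] by simp
  have "subring T R"
  proof (rule subringI)
    show "T \<subseteq> carrier R"
      using homogeneous_carrier by (auto simp: T_def)
    show "\<one> \<in> T"
      by (rule KT[OF one_homogeneous])
  next
    fix h assume "h \<in> T"
    then obtain k y where ky: "h = k \<oplus> y" "k \<in> A 0" "y \<in> genideal R G"
      by (auto simp: T_def)
    then have "\<ominus> h = \<ominus> k \<oplus> \<ominus> y"
      using homogeneous_carrier by (simp add: minus_add)
    then show "\<ominus> h \<in> T"
      using memT[OF minus_homogeneous[OF ky(2)] I.a_inv_closed[OF ky(3)]] by simp
  next
    fix h h' assume "h \<in> T" "h' \<in> T"
    then obtain k y k' y' where ky: "h = k \<oplus> y" "k \<in> A 0" "y \<in> genideal R G"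
      "h' = k' \<oplus> y'" "k' \<in> A 0" "y' \<in> genideal R G"
      unfolding T_def by blast
    have c: "k \<in> carrier R" "k' \<in> carrier R" "y \<in> carrier R" "y' \<in> carrier R"
      using ky homogeneous_carrier by auto
    have "h \<oplus> h' = (k \<oplus> k') \<oplus> (y \<oplus> y')"
      using c ky by (simp add: a_ac)
    then show "h \<oplus> h' \<in> T"
      using memT[OF add_homogeneous[OF ky(2,5)] I.a_closed[OF ky(3,6)]] by simp
    have "h \<otimes> h' = k \<otimes> k' \<oplus> (k \<otimes> y' \<oplus> h' \<otimes> y)"
      using c ky by (simp add: l_distr r_distr m_comm a_ac)
    moreover have "k \<otimes> y' \<oplus> h' \<otimes> y \<in> genideal R G"
      using ky c by (intro I.a_closed I.I_l_closed) auto
    ultimately show "h \<otimes> h' \<in> T"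
      using memT mult_degree[OF ky(2,5)] by simp
  qed
  moreover have "A 0 \<union> S \<subseteq> T"
  proof -
    have "s \<in> T" if s: "s \<in> S" for s
    proof -
      have sc: "s \<in> carrier R"
        using s S by blast
      define F where "F = {i. i > 0 \<and> component s i \<noteq> \<zero>}"
      have F: "finite F"
        using finite_support[OF sc] by (simp add: F_def)
      have "s = (\<Oplus>i\<in>insert 0 F. component s i)"
        using F by (intro component_finsum_superset[OF sc]) (auto simp: F_def)
      also have "\<dots> = component s 0 \<oplus> (\<Oplus>i\<in>F. component s i)"
        using F sc by (intro finsum_insert) (auto simp: F_def)
      finally have "s = component s 0 \<oplus> (\<Oplus>i\<in>F. component s i)" .
      moreover have "(\<Oplus>i\<in>F. component s i) \<in> genideal R G"
      proof (rule I.finsum_mem[OF F])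
        fix i assume "i \<in> F"
        then have "component s i \<in> G"
          using s by (auto simp: G_def F_def)
        then show "component s i \<in> genideal R G"
          using genideal_self[OF Gc] by blast
      qed
      ultimately show ?thesis
        using memT[OF component_homogeneous[OF sc]] by metis
    qed
    with KT show ?thesis
      by blast
  qed
  ultimately have T: "carrier R \<subseteq> T"
    using generate_ring_min_subring1[of "A 0 \<union> S" T] S homogeneous_carrier by blast
  have "x \<in> genideal R G" if n: "n > 0" and x: "x \<in> A n" for n x
  proof -
    obtain k y where ky: "x = k \<oplus> y" "k \<in> A 0" "y \<in> genideal R G"
      using T homogeneous_carrier[OF x] unfolding T_def by blast
    then have "component x n = component k n \<oplus> component y n"
      using homogeneous_carrier by (simp add: component_add)
    then have "x = component y n"
      using n ky component_of_homogeneous[OF x] component_of_homogeneous[OF ky(2)] by simp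
    then show ?thesis
      using homogeneous_ideal_genideal[OF Gh] ky(3) by (auto simp: homogeneous_ideal_def)
  qed
  with fin G show ?thesis
    by blast
qed

end

subsection \<open>Hilbert functions of quotients by regular sequences\<close>

context ring
begin

lemma dimension_dim:
  assumes "subfield K R" "finite_dimension K E"
  shows "dimension (dim K E) K E"
  using finite_dimensionE[OF assms] by (simp add: over_def)

lemma dim_eq:
  assumes "subfield K R" "dimension n K E"
  shows "dim K E = n"
  using dimI[OF assms] by (simp add: over_def)

lemma dim_mono:
  assumes K: "subfield K R" and F: "finite_dimension K F" and E: "subalgebra K E R" "E \<subseteq> F"
  shows "dim K E \<le> dim K F"
proof -
  have "finite_dimension K E"
    by (rule subalbegra_incl_imp_finite_dimension[OF K F E])
  from exists_base[OF K dimension_dim[OF K this]] obtain Us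
    where Us: "independent K Us" "length Us = dim K E" "Span K Us = E" "set Us \<subseteq> carrier R"
    by auto
  have "set Us \<subseteq> F"
    using Span_base_incl[OF K Us(4)] Us(3) E(2) by simp
  with Us show ?thesis
    using independent_length_le_dimension[OF K dimension_dim[OF K F] Us(1)] by simp
qed

lemma set_add_mem_iff: "x \<in> E <+>\<^bsub>R\<^esub> F \<longleftrightarrow> (\<exists>e\<in>E. \<exists>f\<in>F. x = e \<oplus> f)"
  by (auto simp: set_add_def')

end

text \<open>Multiplication by a nonzero element of a domain is an injective linear map, so a flag of
  line extensions is carried to such a flag.\<close>

lemma (in domain) dimension_mult_image:
  assumes K: "subfield K R" and t: "t \<in> carrier R" "t \<noteq> \<zero>" and "dimension n K E"
  shows "dimension n K ((\<otimes>) t ` E)"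
  using assms(4) K
proof (induction rule: dimension.induct)
  case zero_dim
  then show ?case
    using t by simp
next
  case (Suc_dim v E n K)
  note KE = subfieldE(3)[OF Suc_dim.prems] space_subgroup_props(1)[OF Suc_dim.prems Suc_dim.hyps(3)]
  have "t \<otimes> v \<notin> (\<otimes>) t ` E"
    using Suc_dim.hyps t KE m_lcancel by blast
  with Suc_dim t have "dimension (Suc n) K (line_extension K (t \<otimes> v) ((\<otimes>) t ` E))"
    by (intro dimension.Suc_dim) auto
  also have "line_extension K (t \<otimes> v) ((\<otimes>) t ` E) = (\<otimes>) t ` line_extension K v E"
  proof -
    have eq: "t \<otimes> (k \<otimes> v \<oplus> e) = k \<otimes> (t \<otimes> v) \<oplus> t \<otimes> e" if "k \<in> K" "e \<in> E" for k e
    proof -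
      have "k \<in> carrier R" "e \<in> carrier R"
        using that KE by auto
      then show ?thesis
        using t(1) Suc_dim.hyps(1) by (simp add: r_distr m_lcomm)
    qed
    show ?thesis
    proof (intro equalityI subsetI)
      fix x assume "x \<in> line_extension K (t \<otimes> v) ((\<otimes>) t ` E)"
      then obtain k e where "k \<in> K" "e \<in> E" "x = t \<otimes> (k \<otimes> v \<oplus> e)"
        unfolding line_extension_mem_iff using eq by auto
      then show "x \<in> (\<otimes>) t ` line_extension K v E"
        unfolding image_iff Bex_def line_extension_mem_iff by blast
    next
      fix x assume "x \<in> (\<otimes>) t ` line_extension K v E"
      then show "x \<in> line_extension K (t \<otimes> v) ((\<otimes>) t ` E)"
        using eq unfolding line_extension_mem_iff image_iff Bex_def by blast
    qed
  qed
  finally show ?case .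
qed

context positively_graded_domain
begin

text \<open>The Hilbert function of \<open>R/I\<close> for a homogeneous ideal \<open>I\<close>. It
  takes integer values so that the subtraction is not truncated.\<close>

definition quotient_dim :: "'a set \<Rightarrow> nat \<Rightarrow> int" where
  "quotient_dim I n = int (dim (A 0) (A n)) - int (dim (A 0) (I \<inter> A n))"

lemma subalgebra_homogeneous: "subalgebra (A 0) (A n) R"
proof -
  have "subgroup (A n) (add_monoid R)"
    using additive_subgroup.a_subgroup[OF additive] .
  then show ?thesis
    using mult_degree[of _ 0 _ n] by (simp add: subalgebra_def subalgebra_axioms_def)
qed

lemma subalgebra_ideal_homogeneous:
  assumes "ideal I R"
  shows "subalgebra (A 0) (I \<inter> A n) R"
  by (intro subalgebra_inter ideal_is_subalgebra assms subalgebra_homogeneous)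
     (auto dest: homogeneous_carrier)

lemma genideal_empty [simp]: "genideal R {} = {\<zero>}"
  using genideal_minimal[OF zeroideal, of "{}"] additive_subgroup.zero_closed[OF ideal.axioms(1)[OF genideal_ideal[of "{}"]]]
  by auto

text \<open>In degree \<open>n > 0\<close> a generator \<open>g\<close> of degree
  \<open>e > 0\<close> enlarges the ideal by at most \<open>g\<close> times
  \<open>A (n - e)\<close>, which has finite dimension by induction; finitely many generators
  exhaust \<open>A n\<close>. Degree zero is the ground field.\<close>

lemma finite_dimension_homogeneous: "finite_dimension (A 0) (A n)"
proof (induction n rule: less_induct)
  case (less n)
  note K = ground_field
  obtain G where G: "finite G" "\<And>g. g \<in> G \<Longrightarrow> g \<noteq> \<zero> \<and> (\<exists>i>0. g \<in> A i)"
    "\<And>n. n > 0 \<Longrightarrow> A n \<subseteq> genideal R G"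
    using finitely_generated_homogeneous by blast
  have fin: "finite_dimension (A 0) (genideal R F \<inter> A n)" if "finite F" "F \<subseteq> G" for F
    using that
  proof (induction F)
    case empty
    have "{\<zero>} \<inter> A n = {\<zero>}"
      by auto
    then show ?case
      using finite_dimensionI[OF zero_dim, of "A 0"] by simp
  next
    case (insert g F)
    then obtain e where g: "g \<in> A e" "e > 0" "g \<noteq> \<zero>" and gc: "g \<in> carrier R"
      using G(2) homogeneous_carrier by blast
    have F: "F \<subseteq> (\<Union>i. A i)"
      using G(2) insert.prems by blast
    define E where "E = (if e \<le> n then (\<otimes>) g ` A (n - e) else {\<zero>})"
    have E: "finite_dimension (A 0) E"
    proof (cases "e \<le> n")
      case True
      then have "dimension (dim (A 0) (A (n - e))) (A 0) (A (n - e))"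
        using less.IH[of "n - e"] g(2) by (intro dimension_dim[OF K]) auto
      from dimension_mult_image[OF K gc g(3) this] show ?thesis
        using True by (auto simp: E_def intro: finite_dimensionI)
    qed (auto simp: E_def intro: finite_dimensionI)
    have "genideal R (insert g F) \<inter> A n \<subseteq> (genideal R F \<inter> A n) <+>\<^bsub>R\<^esub> E"
    proof
      fix x assume x: "x \<in> genideal R (insert g F) \<inter> A n"
      then obtain y where y: "y \<in> genideal R F \<inter> A n"
        and disj: "x = y \<or> e \<le> n \<and> (\<exists>r\<in>A (n - e). x = y \<oplus> g \<otimes> r)"
        using homogeneous_mem_genideal_insert[OF F g(1), of x n] by blast
      have "\<zero> \<in> E"
        using gc by (auto simp: E_def intro!: image_eqI[of _ _ \<zero>])
      moreover have "y \<oplus> \<zero> = y"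
        using y by (intro r_zero) (auto dest: homogeneous_carrier)
      ultimately have "\<exists>z\<in>E. x = y \<oplus> z"
        using disj by (metis E_def imageI)
      then show "x \<in> (genideal R F \<inter> A n) <+>\<^bsub>R\<^esub> E"
        using y unfolding set_add_mem_iff by blast
    qed
    moreover have "insert g F \<subseteq> carrier R"
      using F gc homogeneous_carrier by auto
    then have "subalgebra (A 0) (genideal R (insert g F) \<inter> A n) R"
      by (intro subalgebra_ideal_homogeneous genideal_ideal)
    moreover have "finite_dimension (A 0) (genideal R F \<inter> A n)"
      using insert by simp
    ultimately show ?case
      using subalbegra_incl_imp_finite_dimension[OF K sum_space_dim(1)[OF K _ E]] by blast
  qed
  show ?case
  proof (cases "n = 0")
    case True
    then show ?thesis
      using finite_dimensionI[OF dimension_one[OF K]] by simp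
  next
    case False
    then have "genideal R G \<inter> A n = A n"
      using G(3) by blast
    then show ?thesis
      using fin[OF G(1)] by simp
  qed
qed

lemma finite_dimension_ideal_homogeneous:
  "ideal I R \<Longrightarrow> finite_dimension (A 0) (I \<inter> A n)"
  using subalbegra_incl_imp_finite_dimension[OF ground_field finite_dimension_homogeneous
      subalgebra_ideal_homogeneous] by blast

lemma dim_mult_image:
  assumes "t \<in> carrier R" "t \<noteq> \<zero>" "finite_dimension (A 0) E"
  shows "dim (A 0) ((\<otimes>) t ` E) = dim (A 0) E" "finite_dimension (A 0) ((\<otimes>) t ` E)"
  using dimension_mult_image[OF ground_field assms(1,2) dimension_dim[OF ground_field assms(3)]]
    dim_eq[OF ground_field] finite_dimensionI by blast+

text \<open>Exactness of \<open>0 \<rightarrow> (R/I)(-e) \<rightarrow> R/I \<rightarrow> R/(I, t) \<rightarrow> 0\<close> in degree \<open>n\<close>.\<close>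

lemma quotient_dim_insert:
  assumes S: "S \<subseteq> (\<Union>i. A i)" and t: "t \<in> A e" "t \<noteq> \<zero>"
    and nzd: "\<And>x. x \<in> carrier R \<Longrightarrow> t \<otimes> x \<in> genideal R S \<Longrightarrow> x \<in> genideal R S"
  shows "quotient_dim (genideal R (insert t S)) n =
    quotient_dim (genideal R S) n - (if e \<le> n then quotient_dim (genideal R S) (n - e) else 0)"
proof -
  define I where "I = genideal R S"
  define I' where "I' = genideal R (insert t S)"
  have Sc: "insert t S \<subseteq> carrier R" and tc: "t \<in> carrier R"
    using S t homogeneous_carrier by blast+
  interpret I: ideal I R
    unfolding I_def using Sc by (intro genideal_ideal) auto
  interpret I': ideal I' R
    unfolding I'_def by (rule genideal_ideal[OF Sc])
  have sub: "I \<subseteq> I'" "t \<in> I'"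
    using genideal_self[OF Sc] genideal_minimal[OF I'.is_ideal, of S] by (auto simp: I_def I'_def)
  have mem: "\<exists>y\<in>I \<inter> A n. x = y \<or> e \<le> n \<and> (\<exists>r\<in>A (n - e). x = y \<oplus> t \<otimes> r)" if "x \<in> I' \<inter> A n" for x
    using homogeneous_mem_genideal_insert[OF S t(1), of x n] that by (simp add: I_def I'_def)
  show ?thesis
  proof (cases "e \<le> n")
    case False
    then have "I' \<inter> A n = I \<inter> A n"
      using mem sub(1) by blast
    with False show ?thesis
      by (simp add: quotient_dim_def flip: I_def I'_def)
  next
    case True
    define m where "m = n - e"
    have tA: "t \<otimes> r \<in> A n" if "r \<in> A m" for r
      using mult_degree[OF t(1) that] True by (simp add: m_def)
    have fin: "finite_dimension (A 0) ((\<otimes>) t ` A m)" "finite_dimension (A 0) (I \<inter> A n)"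
      "finite_dimension (A 0) (I \<inter> A m)"
      by (intro dim_mult_image(2) tc t finite_dimension_homogeneous
          finite_dimension_ideal_homogeneous I.is_ideal)+
    have sum: "I' \<inter> A n = (I \<inter> A n) <+>\<^bsub>R\<^esub> (\<otimes>) t ` A m"
    proof (intro equalityI subsetI)
      fix x assume "x \<in> I' \<inter> A n"
      then obtain y where y: "y \<in> I \<inter> A n" and disj: "x = y \<or> (\<exists>r\<in>A m. x = y \<oplus> t \<otimes> r)"
        using mem by (auto simp: m_def)
      have "y = y \<oplus> t \<otimes> \<zero>"
        using y homogeneous_carrier tc by simp
      then have "\<exists>r\<in>A m. x = y \<oplus> t \<otimes> r"
        using disj zero_homogeneous by blast
      then show "x \<in> (I \<inter> A n) <+>\<^bsub>R\<^esub> (\<otimes>) t ` A m"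
        using y unfolding set_add_mem_iff by blast
    next
      fix x assume "x \<in> (I \<inter> A n) <+>\<^bsub>R\<^esub> (\<otimes>) t ` A m"
      then obtain y r where "y \<in> I \<inter> A n" "r \<in> A m" "x = y \<oplus> t \<otimes> r"
        unfolding set_add_mem_iff by blast
      then show "x \<in> I' \<inter> A n"
        using sub tA homogeneous_carrier by (auto intro!: add_homogeneous I'.a_closed I'.I_r_closed)
    qed
    \<comment> \<open>The regularity of \<open>t\<close> modulo \<open>I\<close> enters here. The
      dimension formula for a sum then applies, with both images under \<open>t\<close> keeping
      their dimensions since \<open>R\<close> is a domain.\<close>
    have inter: "(I \<inter> A n) \<inter> (\<otimes>) t ` A m = (\<otimes>) t ` (I \<inter> A m)"
    proof -
      have "t \<otimes> r \<in> I \<longleftrightarrow> r \<in> I" if "r \<in> A m" for r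
        using nzd[of r] homogeneous_carrier[OF that] I.I_l_closed[OF _ tc] by (auto simp: I_def)
      then show ?thesis
        using tA by auto
    qed
    have "dim (A 0) (I' \<inter> A n) = dim (A 0) (I \<inter> A n) + dim (A 0) (A m) - dim (A 0) (I \<inter> A m)"
      using sum_space_dim(2)[OF ground_field fin(2,1)]
      by (simp add: over_def sum inter dim_mult_image tc t fin finite_dimension_homogeneous)
    \<comment> \<open>This makes the subtraction of natural numbers just above a true one when
      passing to integers.\<close>
    moreover have "dim (A 0) (I \<inter> A m) \<le> dim (A 0) (A m)"
      by (intro dim_mono ground_field finite_dimension_homogeneous subalgebra_ideal_homogeneous
          I.is_ideal) auto
    ultimately show ?thesis
      using True by (simp add: quotient_dim_def flip: I_def I'_def m_def)
  qed
qed

lemma quotient_dim_zero: "quotient_dim {\<zero>} n = int (dim (A 0) (A n))"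
proof -
  have "{\<zero>} \<inter> A n = {\<zero>}"
    by auto
  then show ?thesis
    using dim_eq[OF ground_field zero_dim] by (simp add: quotient_dim_def)
qed

text \<open>Multiplying a generating function by \<open>1 - z^e\<close> takes the difference of its
  values at \<open>n\<close> and \<open>n - e\<close>, which is the effect of adjoining one more
  regular element of degree \<open>e\<close>. The members must be nonzero for multiplication by them
  to preserve dimensions.\<close>

lemma hilbert_series_mult_prod:
  fixes \<theta> es
  assumes deg: "list_all2 (\<lambda>t e. t \<in> A e \<and> t \<noteq> \<zero>) \<theta> es"
    and nzd: "\<And>i x. i < length \<theta> \<Longrightarrow> x \<in> carrier R \<Longrightarrow>
      (\<theta> ! i) \<otimes> x \<in> genideal R (set (take i \<theta>)) \<Longrightarrow> x \<in> genideal R (set (take i \<theta>))"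
  shows "hilbert_series R A * (\<Prod>e\<leftarrow>es. 1 - fps_X ^ e) =
    Abs_fps (\<lambda>n. of_int (quotient_dim (genideal R (set \<theta>)) n))"
  using assms
proof (induction \<theta> arbitrary: es rule: rev_induct)
  case Nil
  then show ?case
    by (simp add: hilbert_series_def quotient_dim_zero)
next
  case (snoc t \<theta>)
  then obtain fs e where es: "es = fs @ [e]" and \<theta>: "list_all2 (\<lambda>t e. t \<in> A e \<and> t \<noteq> \<zero>) \<theta> fs"
    and t: "t \<in> A e" "t \<noteq> \<zero>"
    by (auto simp: list_all2_append1 list_all2_Cons1)
  have S: "set \<theta> \<subseteq> (\<Union>i. A i)"
    using \<theta> by (fastforce simp: list_all2_conv_all_nth in_set_conv_nth)
  have nzd: "x \<in> genideal R (set \<theta>)" if "x \<in> carrier R" "t \<otimes> x \<in> genideal R (set \<theta>)" for x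
    using snoc.prems(2)[of "length \<theta>" x] that by simp
  have "hilbert_series R A * (\<Prod>e\<leftarrow>fs. 1 - fps_X ^ e) =
      Abs_fps (\<lambda>n. of_int (quotient_dim (genideal R (set \<theta>)) n))"
  proof (rule snoc.IH[OF \<theta>])
    fix i x assume "i < length \<theta>" "x \<in> carrier R" "(\<theta> ! i) \<otimes> x \<in> genideal R (set (take i \<theta>))"
    then show "x \<in> genideal R (set (take i \<theta>))"
      using snoc.prems(2)[of i x] by (simp add: nth_append)
  qed
  then have "hilbert_series R A * (\<Prod>e\<leftarrow>es. 1 - fps_X ^ e) =
      Abs_fps (\<lambda>n. of_int (quotient_dim (genideal R (set \<theta>)) n)) * (1 - fps_X ^ e)"
    by (simp add: es flip: mult.assoc)
  also have "\<dots> = Abs_fps (\<lambda>n. of_int (quotient_dim (genideal R (insert t (set \<theta>))) n))"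
    by (auto simp: fps_eq_iff right_diff_distrib fps_X_power_mult_right_nth
        quotient_dim_insert[OF S t nzd])
  finally show ?case
    by simp
qed

section \<open>Vanishing of the quotient in high degrees\<close>

lemma nilpotent_mod_regular_sequence:
  assumes dim: "krull_dim R = enat (length \<theta>)"
    and \<theta>: "homogeneous_regular_sequence R A \<theta>"
    and x: "x \<in> A i" "i > 0"
  shows "\<exists>n::nat. x [^] n \<in> genideal R (set \<theta>)"
proof (rule ccontr)
  assume nilp: "\<not> ?thesis"
  define I where "I = genideal R (set \<theta>)"
  \<comment> \<open>This is the ideal of elements without part in degree zero; it is prime because
    taking the degree zero component is multiplicative and its values lie in a domain.\<close>
  define P where "P = {y \<in> carrier R. component y 0 = \<zero>}"
  have \<theta>h: "\<forall>t\<in>set \<theta>. \<exists>i>0. t \<in> A i"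
    using \<theta> by (simp add: homogeneous_regular_sequence_def)
  then have \<theta>c: "set \<theta> \<subseteq> carrier R"
    by (auto dest: homogeneous_carrier)
  have hI: "homogeneous_ideal I"
    unfolding I_def using \<theta>h by (intro homogeneous_ideal_genideal) blast
  interpret I: ideal I R
    using hI by (simp add: homogeneous_ideal_def)
  have xc: "x \<in> carrier R"
    using x homogeneous_carrier by blast
  have mult0: "component (y \<otimes> z) 0 = component y 0 \<otimes> component z 0"
    if "y \<in> carrier R" "z \<in> carrier R" for y z
    using that(1)
  proof (induction rule: carrier_homogeneous_induct)
    case (homogeneous j y)
    then show ?case
      using that(2) by (simp add: component_mult component_of_homogeneous)
  next
    case (add y y')
    then show ?case
      using that(2) by (simp add: component_add l_distr)
  qed
  have "ideal P R"
  proof (rule idealI[OF ring_axioms])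
    show "subgroup P (add_monoid R)"
    proof (rule add.subgroupI)
      show "\<ominus> y \<in> P" if "y \<in> P" for y
        using that mult0[of "\<ominus> \<one>" y] by (simp add: P_def l_minus)
      show "P \<noteq> {}"
        using component_zero by (auto simp: P_def)
    qed (auto simp: P_def component_add)
  qed (auto simp: P_def mult0)
  then have P: "primeideal P R"
  proof (rule primeidealI[OF _ is_cring])
    have "\<one> \<notin> P"
      by (simp add: P_def component_of_homogeneous[OF one_homogeneous])
    then show "carrier R \<noteq> P"
      by blast
    show "a \<in> P \<or> b \<in> P" if "a \<in> carrier R" "b \<in> carrier R" "a \<otimes> b \<in> P" for a b
      using that mult0 integral by (auto simp: P_def)
  qed
  have hP: "y \<in> P" if "y \<in> A j" "j > 0" for y j
    using that homogeneous_carrier by (simp add: P_def component_of_homogeneous)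
  have \<theta>P: "set \<theta> \<subseteq> P"
    using \<theta>h hP by blast
  then have IP: "I \<subseteq> P"
    unfolding I_def by (intro genideal_minimal primeideal.axioms(1)[OF P])
  have "\<exists>P'. primeideal P' R \<and> I \<subseteq> P' \<and> P' \<subset> P"
  proof (rule exists_primeideal_below[OF P I.is_ideal IP hP[OF x]])
    fix n :: nat and s assume s: "s \<in> carrier R" "x [^] n \<otimes> s \<in> I"
    have xn: "x [^] n \<in> A (n * i)"
    proof (induction n)
      case (Suc n)
      then show ?case
        using mult_degree[OF Suc x(1)] by (simp add: add.commute)
    qed simp
    \<comment> \<open>In degree \<open>n * i\<close> the product has component \<open>x^n\<close>
      times the degree zero part of \<open>s\<close>. For \<open>s \<notin> P\<close> that part is a
      unit, so \<open>x^n\<close> would lie in \<open>I\<close>.\<close>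
    have "component (x [^] n \<otimes> s) (n * i) \<in> I"
      using hI s(2) by (auto simp: homogeneous_ideal_def)
    then have c: "x [^] n \<otimes> component s 0 \<in> I"
      by (simp add: component_mult[OF xn s(1)])
    show "s \<in> P"
    proof (rule ccontr)
      assume "s \<notin> P"
      then have "component s 0 \<in> A 0 - {\<zero>}"
        using s(1) component_homogeneous by (auto simp: P_def)
      note inv = subfield_m_inv[OF ground_field this]
      have ic: "inv component s 0 \<in> carrier R"
        using inv(1) homogeneous_carrier by blast
      have "(x [^] n \<otimes> component s 0) \<otimes> inv component s 0 = x [^] n"
        using s(1) ic xc inv(2) by (simp add: m_assoc)
      then have "x [^] n \<in> I"
        using I.I_r_closed[OF c ic] by simp
      then show False
        using nilp by (auto simp: I_def)
    qed
  qed
  then obtain P' where P': "primeideal P' R" "I \<subseteq> P'" "P' \<subset> P"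
    by blast
  have "set \<theta> \<subseteq> P'"
    using genideal_self[OF \<theta>c] P'(2) by (auto simp: I_def)
  moreover have "y \<in> genideal R (set (take j \<theta>))"
    if "j < length \<theta>" "y \<in> carrier R" "(\<theta> ! j) \<otimes> y \<in> genideal R (set (take j \<theta>))" for j y
    using \<theta> that by (simp add: homogeneous_regular_sequence_def)
  ultimately obtain p where p: "p (length \<theta>) = P'" "\<forall>i\<le>length \<theta>. primeideal (p i) R"
    "\<forall>i<length \<theta>. p i \<subset> p (Suc i)"
    using prime_chain_below_regular_sequence[OF \<theta>c _ P'(1)] by blast
  \<comment> \<open>The chain below \<open>P'\<close> already has length \<open>d\<close>; putting
    \<open>P\<close> on top makes it one longer than the Krull dimension allows.\<close>
  define q where "q = p(Suc (length \<theta>) := P)"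
  have "\<forall>i\<le>Suc (length \<theta>). primeideal (q i) R"
    using p(2) P by (auto simp: q_def)
  moreover have "\<forall>i<Suc (length \<theta>). q i \<subset> q (Suc i)"
    using p(1,3) P'(3) by (auto simp: q_def less_Suc_eq)
  ultimately have "enat (Suc (length \<theta>)) \<le> krull_dim R"
    unfolding krull_dim_def by (intro Sup_upper) blast
  with dim show False
    by simp
qed

text \<open>While the degree is at least \<open>M\<close>, an element is congruent modulo
  \<open>S\<close> to \<open>t\<close> times an element of degree lower by \<open>e\<close>. After
  \<open>N\<close> rounds the accumulated factor \<open>t^N\<close> lies in the ideal, and
  \<open>M + N * e\<close> leaves room for all the rounds.\<close>

lemma cofinite_remove_nilpotent:
  fixes N M :: nat
  assumes S: "S \<subseteq> (\<Union>i. A i)" and t: "t \<in> A e" "e > 0"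
    and N: "t [^] N \<in> genideal R S"
    and M: "\<And>n. n \<ge> M \<Longrightarrow> A n \<subseteq> genideal R (insert t S)"
    and n: "n \<ge> M + N * e"
  shows "A n \<subseteq> genideal R S"
proof
  fix x assume x: "x \<in> A n"
  have Sc: "S \<subseteq> carrier R" and tc: "t \<in> carrier R"
    using S t homogeneous_carrier by blast+
  interpret I: ideal "genideal R S" R
    by (rule genideal_ideal[OF Sc])
  have "\<exists>y\<in>genideal R S. \<exists>r\<in>A (n - k * e). x = y \<oplus> t [^] k \<otimes> r" if "k \<le> N" for k :: nat
    using that
  proof (induction k)
    case 0
    have "x = \<zero> \<oplus> t [^] (0 :: nat) \<otimes> x"
      using x homogeneous_carrier by simp
    then show ?case
      using x I.zero_closed by auto
  next
    case (Suc k)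
    then obtain y r where y: "y \<in> genideal R S" and r: "r \<in> A (n - k * e)"
      and eq: "x = y \<oplus> t [^] k \<otimes> r"
      by auto
    have "Suc k * e \<le> N * e"
      using Suc.prems by (rule mult_le_mono1)
    then have le: "M + (e + k * e) \<le> n"
      using n by simp
    then have "M \<le> n - k * e"
      by linarith
    then have "r \<in> genideal R (insert t S)" and e: "n - k * e - e = n - Suc k * e"
      using M[of "n - k * e"] r by auto
    then obtain y' where y': "y' \<in> genideal R S"
      and disj: "r = y' \<or> (\<exists>r'\<in>A (n - Suc k * e). r = y' \<oplus> t \<otimes> r')"
      using homogeneous_mem_genideal_insert[OF S t(1) r] by auto
    then have "\<exists>r'\<in>A (n - Suc k * e). r = y' \<oplus> t \<otimes> r'"
      using zero_homogeneous tc I.Icarr by (metis r_null r_zero)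
    then obtain r' where r': "r' \<in> A (n - Suc k * e)" "r = y' \<oplus> t \<otimes> r'"
      by blast
    have c: "y \<in> carrier R" "y' \<in> carrier R" "r' \<in> carrier R"
      using y y' r' I.Icarr homogeneous_carrier by auto
    have "x = (y \<oplus> t [^] k \<otimes> y') \<oplus> t [^] Suc k \<otimes> r'"
      using c tc by (simp add: eq r'(2) r_distr a_assoc m_assoc)
    moreover have "y \<oplus> t [^] k \<otimes> y' \<in> genideal R S"
      using y y' tc by (intro I.a_closed I.I_l_closed) auto
    ultimately show ?case
      using r'(1) by blast
  qed
  then obtain y r where "y \<in> genideal R S" "r \<in> A (n - N * e)" "x = y \<oplus> t [^] N \<otimes> r"
    by blast
  then show "x \<in> genideal R S"
    using N homogeneous_carrier by (auto intro!: I.a_closed I.I_r_closed)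
qed

text \<open>Together with \<open>G\<close> the sequence generates an ideal containing every positive
  degree; the finitely many members of \<open>G\<close>, each nilpotent modulo
  \<open>\<theta>\<close>, are then dropped one at a time.\<close>

lemma cofinite_regular_sequence:
  assumes dim: "krull_dim R = enat (length \<theta>)"
    and \<theta>: "homogeneous_regular_sequence R A \<theta>"
  shows "\<exists>M. \<forall>n\<ge>M. A n \<subseteq> genideal R (set \<theta>)"
proof -
  obtain G where G: "finite G" "\<And>g. g \<in> G \<Longrightarrow> \<exists>i>0. g \<in> A i"
    "\<And>n. n > 0 \<Longrightarrow> A n \<subseteq> genideal R G"
    using finitely_generated_homogeneous by blast
  have \<theta>h: "set \<theta> \<subseteq> (\<Union>i. A i)"
    using \<theta> by (auto simp: homogeneous_regular_sequence_def)
  have mono: "genideal R S \<subseteq> genideal R T" if "S \<subseteq> T" "T \<subseteq> (\<Union>i. A i)" for S T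
  proof -
    have "T \<subseteq> carrier R"
      using that homogeneous_carrier by blast
    then show ?thesis
      using that(1) genideal_self[of T] by (intro genideal_minimal genideal_ideal) auto
  qed
  have step: "\<exists>M. \<forall>n\<ge>M. A n \<subseteq> genideal R (set \<theta>)"
    if "finite F" "F \<subseteq> G" "\<exists>M. \<forall>n\<ge>M. A n \<subseteq> genideal R (F \<union> set \<theta>)" for F
    using that
  proof (induction F)
    case (insert g F)
    then obtain e where g: "g \<in> A e" "e > 0"
      using G(2) by blast
    have "F \<subseteq> (\<Union>i. A i)"
      using insert.prems(1) G(2) by blast
    with \<theta>h have F: "F \<union> set \<theta> \<subseteq> (\<Union>i. A i)"
      by (rule Un_least[rotated])
    obtain N where "g [^] (N::nat) \<in> genideal R (set \<theta>)"
      using nilpotent_mod_regular_sequence[OF dim \<theta> g] by blast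
    then have N: "g [^] N \<in> genideal R (F \<union> set \<theta>)"
      by (rule subsetD[OF mono[OF Un_upper2 F]])
    obtain M where M: "\<And>n. n \<ge> M \<Longrightarrow> A n \<subseteq> genideal R (insert g (F \<union> set \<theta>))"
      using insert.prems by auto
    have "\<forall>n\<ge>M + N * e. A n \<subseteq> genideal R (F \<union> set \<theta>)"
      using cofinite_remove_nilpotent[OF F g N M] by blast
    then show ?case
      using insert by blast
  qed simp
  have "G \<subseteq> (\<Union>i. A i)"
    using G(2) by blast
  with \<theta>h have "G \<union> set \<theta> \<subseteq> (\<Union>i. A i)"
    by (rule Un_least[rotated])
  then have "genideal R G \<subseteq> genideal R (G \<union> set \<theta>)"
    by (rule mono[OF Un_upper1])
  with G(3) have "A n \<subseteq> genideal R (G \<union> set \<theta>)" if "n \<ge> 1" for n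
    using that by (metis One_nat_def Suc_le_eq order_trans)
  then show ?thesis
    using step[OF G(1)] by blast
qed

end

subsection \<open>Symmetry from a one-dimensional socle\<close>

lemma (in ring) subalgebraI:
  assumes K: "subfield K R" and E: "E \<subseteq> carrier R" "\<zero> \<in> E"
    and add: "\<And>x y. x \<in> E \<Longrightarrow> y \<in> E \<Longrightarrow> x \<oplus> y \<in> E"
    and smult: "\<And>k x. k \<in> K \<Longrightarrow> x \<in> E \<Longrightarrow> k \<otimes> x \<in> E"
  shows "subalgebra K E R"
proof -
  note KR = subringE[OF subfieldE(1)[OF K]]
  have "subgroup E (add_monoid R)"
  proof (rule add.subgroupI)
    fix x assume x: "x \<in> E"
    then have "\<ominus> x = (\<ominus> \<one>) \<otimes> x"
      using E(1) by (simp add: l_minus subset_iff)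
    also have "\<dots> \<in> E"
      by (intro smult KR x)
    finally show "\<ominus> x \<in> E" .
  qed (use E add in auto)
  with smult show ?thesis
    by (simp add: subalgebra_def subalgebra_axioms_def)
qed

text \<open>Each vector of a basis of \<open>V\<close> modulo \<open>I \<inter> V\<close> imposes one linear condition on \<open>U\<close>; together
  these conditions cut out \<open>I \<inter> U\<close>.\<close>

lemma (in cring) dim_le_of_nondegenerate_pairing:
  assumes K: "subfield K R" and I: "ideal I R" and w: "w \<in> carrier R"
    and U: "subalgebra K U R" "finite_dimension K U"
    and V: "subalgebra K V R" "finite_dimension K V"
    and line: "\<And>u v. u \<in> U \<Longrightarrow> v \<in> V \<Longrightarrow> \<exists>c\<in>K. \<exists>z\<in>I. u \<otimes> v = c \<otimes> w \<oplus> z"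
    and nondegenerate: "\<And>u. u \<in> U \<Longrightarrow> (\<And>v. v \<in> V \<Longrightarrow> u \<otimes> v \<in> I) \<Longrightarrow> u \<in> I"
  shows "dim K U + dim K (I \<inter> V) \<le> dim K V + dim K (I \<inter> U)"
proof -
  interpret I: ideal I R by fact
  interpret U: subalgebra K U R by fact
  interpret V: subalgebra K V R by fact
  have Kc: "K \<subseteq> carrier R"
    by (rule subfieldE(3)[OF K])
  have Uc: "u \<in> carrier R" if "u \<in> U" for u
    using subalgebra_in_carrier[OF U(1)] that by blast
  have Vc: "v \<in> carrier R" if "v \<in> V" for v
    using subalgebra_in_carrier[OF V(1)] that by blast
  have cl: "\<zero> \<in> U" "\<And>x y. x \<in> U \<Longrightarrow> y \<in> U \<Longrightarrow> x \<oplus> y \<in> U"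
    using U.one_closed U.m_closed by simp_all
  define W where "W Vs = {u \<in> U. \<forall>v\<in>set Vs. u \<otimes> v \<in> I}" for Vs
  have W: "subalgebra K (W Vs) R" if "set Vs \<subseteq> V" for Vs
  proof (rule subalgebraI[OF K])
    have Vsc: "v \<in> carrier R" if "v \<in> set Vs" for v
      using that \<open>set Vs \<subseteq> V\<close> Vc by blast
    show "W Vs \<subseteq> carrier R"
      using Uc by (auto simp: W_def)
    show "\<zero> \<in> W Vs"
      using cl Vsc by (simp add: W_def)
    show "x \<oplus> y \<in> W Vs" if "x \<in> W Vs" "y \<in> W Vs" for x y
      using that Uc cl Vsc by (auto simp: W_def l_distr)
    show "k \<otimes> x \<in> W Vs" if "k \<in> K" "x \<in> W Vs" for k x
    proof -
      have "k \<otimes> x \<otimes> v \<in> I" if "v \<in> set Vs" for v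
      proof -
        have "x \<otimes> v \<in> I"
          using \<open>x \<in> W Vs\<close> that by (simp add: W_def)
        from I.I_l_closed[OF this] have "k \<otimes> (x \<otimes> v) \<in> I"
          using \<open>k \<in> K\<close> Kc by blast
        then show ?thesis
          using \<open>k \<in> K\<close> \<open>x \<in> W Vs\<close> that Kc Uc Vsc by (simp add: W_def m_assoc subset_iff)
      qed
      with that show ?thesis
        using U.smult_closed by (simp add: W_def)
    qed
  qed
  have finW: "finite_dimension K (W Vs)" if "set Vs \<subseteq> V" for Vs
    by (rule subalbegra_incl_imp_finite_dimension[OF K U(2) W[OF that]]) (auto simp: W_def)
  have step: "dim K U \<le> dim K (W Vs) + length Vs" if "set Vs \<subseteq> V" for Vs
    using that
  proof (induction Vs)
    case Nil
    then show ?case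
      by (simp add: W_def)
  next
    case (Cons v Vs)
    then have v: "v \<in> V" "v \<in> carrier R" and Vs: "set Vs \<subseteq> V"
      using Vc by auto
    note WC = W[OF Cons.prems] finW[OF Cons.prems]
    \<comment> \<open>One more condition lowers the dimension by at most one: products with
      \<open>v\<close> lie on the line of \<open>w\<close> modulo \<open>I\<close>, so a single
      \<open>u\<close> violating the condition spans a complement.\<close>
    have "dim K (W Vs) \<le> Suc (dim K (W (v # Vs)))"
    proof (cases "W Vs \<subseteq> W (v # Vs)")
      case True
      then have "dim K (W Vs) \<le> dim K (W (v # Vs))"
        by (intro dim_mono K WC W[OF Vs])
      then show ?thesis
        by simp
    next
      case False
      then obtain u where u: "u \<in> W Vs" "u \<notin> W (v # Vs)"
        by blast
      then have uU: "u \<in> U" "u \<in> carrier R" and uv: "u \<otimes> v \<notin> I"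
        using Uc by (auto simp: W_def)
      obtain c z where c: "c \<in> K" "z \<in> I" "u \<otimes> v = c \<otimes> w \<oplus> z"
        using line[OF uU(1) v(1)] by blast
      have "c \<noteq> \<zero>"
        using c uv w by auto
      then have "c \<in> K - {\<zero>}"
        using c by simp
      note inv = subfield_m_inv[OF K this]
      have dim: "dimension (Suc (dim K (W (v # Vs)))) K (line_extension K u (W (v # Vs)))"
        by (intro dimension.Suc_dim uU u dimension_dim[OF K] WC)
      have "W Vs \<subseteq> line_extension K u (W (v # Vs))"
      proof
        fix x assume x: "x \<in> W Vs"
        then have xU: "x \<in> U" "x \<in> carrier R"
          using Uc by (auto simp: W_def)
        obtain c' z' where c': "c' \<in> K" "z' \<in> I" "x \<otimes> v = c' \<otimes> w \<oplus> z'"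
          using line[OF xU(1) v(1)] by blast
        \<comment> \<open>The ratio for which the multiples of \<open>w\<close> in
          \<open>(x - k u) v\<close> cancel.\<close>
        define k where "k = c' \<otimes> inv c"
        have k: "k \<in> K" "\<ominus> k \<in> K"
          using subringE(5,6)[OF subfieldE(1)[OF K]] c'(1) inv(1) by (auto simp: k_def)
        have car: "k \<in> carrier R" "c \<in> carrier R" "c' \<in> carrier R" "inv c \<in> carrier R"
          "z \<in> carrier R" "z' \<in> carrier R"
          using k c c' inv Kc I.Icarr by auto
        have kc: "k \<otimes> c = c'"
          using car inv(3) by (simp add: k_def m_assoc)
        define y where "y = (\<ominus> k) \<otimes> u \<oplus> x"
        have yc: "y \<in> carrier R"
          using car uU xU by (simp add: y_def)
        have "y \<otimes> v = \<ominus> (k \<otimes> (u \<otimes> v)) \<oplus> x \<otimes> v"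
          using car uU xU v by (simp add: y_def l_distr l_minus m_assoc)
        also have "k \<otimes> (u \<otimes> v) = c' \<otimes> w \<oplus> k \<otimes> z"
          using car w by (simp add: c(3) r_distr kc flip: m_assoc)
        also have "\<ominus> (c' \<otimes> w \<oplus> k \<otimes> z) \<oplus> x \<otimes> v = \<ominus> (k \<otimes> z) \<oplus> z'"
        proof -
          have "\<ominus> (p \<oplus> q) \<oplus> (p \<oplus> r) = \<ominus> q \<oplus> r"
            if "p \<in> carrier R" "q \<in> carrier R" "r \<in> carrier R" for p q r
            using that by algebra
          then show ?thesis
            using car w by (simp add: c'(3))
        qed
        also have "\<dots> \<in> I"
          using c c' car by (intro I.a_closed I.a_inv_closed I.I_l_closed)
        finally have "y \<otimes> v \<in> I" .
        moreover have "y \<in> W Vs"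
          using subalgebra.smult_closed[OF W[OF Vs] k(2) u(1)] x
            subgroup.m_closed[OF subalgebra.axioms(1)[OF W[OF Vs]]] by (simp add: y_def)
        ultimately have "y \<in> W (v # Vs)"
          by (simp add: W_def)
        moreover have "x = k \<otimes> u \<oplus> y"
          using car uU xU by (simp add: y_def l_minus r_neg1 a_assoc[symmetric] r_neg)
        ultimately show "x \<in> line_extension K u (W (v # Vs))"
          unfolding line_extension_mem_iff using k(1) by blast
      qed
      then have "dim K (W Vs) \<le> dim K (line_extension K u (W (v # Vs)))"
        by (intro dim_mono[OF K finite_dimensionI[OF dim]] W[OF Vs])
      then show ?thesis
        by (simp add: dim_eq[OF K dim])
    qed
    then show ?case
      using Cons.IH[OF Vs] by simp
  qed
  have IV: "subalgebra K (I \<inter> V) R" and IU: "subalgebra K (I \<inter> U) R"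
    by (intro subalgebra_inter ideal_is_subalgebra Kc I U V)+
  have fin: "finite_dimension K (I \<inter> V)" "finite_dimension K (I \<inter> U)"
    using subalbegra_incl_imp_finite_dimension[OF K V(2) IV]
      subalbegra_incl_imp_finite_dimension[OF K U(2) IU] by auto
  obtain Us where Us: "independent K Us" "length Us = dim K (I \<inter> V)" "Span K Us = I \<inter> V"
    "set Us \<subseteq> carrier R"
    using exists_base[OF K dimension_dim[OF K fin(1)]] by auto
  then have UsI: "set Us \<subseteq> I \<inter> V"
    using Span_base_incl[OF K] by blast
  then obtain Vs where Vs: "length (Vs @ Us) = dim K V" "independent K (Vs @ Us)"
    "Span K (Vs @ Us) = V"
    using complete_base[OF K dimension_dim[OF K V(2)] Us(1)] by auto
  have VsV: "set (Vs @ Us) \<subseteq> V"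
    using Span_base_incl[OF K independent_in_carrier[OF Vs(2)]] Vs(3) by simp
  have "W Vs \<subseteq> I \<inter> U"
  proof
    fix u assume u: "u \<in> W Vs"
    then have uU: "u \<in> U" "u \<in> carrier R"
      using Uc by (auto simp: W_def)
    \<comment> \<open>The vectors pairing with \<open>u\<close> into \<open>I\<close> form a
      subspace; it contains \<open>Vs\<close> by the choice of \<open>u\<close> and
      \<open>Us\<close> because these lie in \<open>I\<close>, hence all of
      \<open>V\<close>.\<close>
    define Z where "Z = {v \<in> carrier R. u \<otimes> v \<in> I}"
    have "subalgebra K Z R"
    proof (rule subalgebraI[OF K])
      show "k \<otimes> x \<in> Z" if "k \<in> K" "x \<in> Z" for k x
      proof -
        have "u \<otimes> (k \<otimes> x) = k \<otimes> (u \<otimes> x)" "k \<in> carrier R"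
          using that Kc uU by (auto simp: Z_def m_lcomm)
        with that show ?thesis
          using I.I_l_closed[of "u \<otimes> x" k] by (simp add: Z_def)
      qed
    qed (use uU in \<open>auto simp: Z_def r_distr\<close>)
    moreover have "set (Vs @ Us) \<subseteq> Z"
      using u UsI VsV Vc uU I.I_l_closed by (auto simp: W_def Z_def)
    ultimately have "V \<subseteq> Z"
      using subalgebra_Span_incl[OF K, of Z "Vs @ Us"] Vs(3) by simp
    then show "u \<in> I \<inter> U"
      using nondegenerate[OF uU(1)] uU by (auto simp: Z_def)
  qed
  then have "dim K (W Vs) \<le> dim K (I \<inter> U)"
    using VsV by (intro dim_mono K fin W) auto
  moreover have "dim K U \<le> dim K (W Vs) + length Vs"
    using VsV by (intro step) auto
  ultimately show ?thesis
    using Vs(1) Us(2) by simp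
qed

section \<open>The pairing into the socle degree\<close>

context positively_graded_domain
begin

lemma quotient_dim_0:
  assumes I: "ideal I R" "I \<noteq> carrier R"
  shows "quotient_dim I 0 = 1"
proof -
  interpret I: ideal I R by fact
  have "I \<inter> A 0 = {\<zero>}"
  proof -
    have "c = \<zero>" if c: "c \<in> I" "c \<in> A 0" for c
    proof (rule ccontr)
      assume "c \<noteq> \<zero>"
      then have inv: "inv c \<in> A 0 - {\<zero>}" "inv c \<otimes> c = \<one>"
        using subfield_m_inv[OF ground_field, of c] c by auto
      then have "inv c \<otimes> c \<in> I"
        using c homogeneous_carrier by (intro I.I_l_closed) auto
      then show False
        using inv I.one_imp_carrier I(2) by simp
    qed
    then show ?thesis
      by auto
  qed
  then show ?thesis
    using dim_eq[OF ground_field zero_dim] dim_eq[OF ground_field dimension_one[OF ground_field]]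
    by (simp add: quotient_dim_def)
qed

text \<open>The generator \<open>w\<close> need not be homogeneous, so it is replaced by a component
  \<open>w'\<close> outside \<open>I\<close>, which again spans the socle. Nondegeneracy of the
  pairing comes from multiplying a given \<open>x \<notin> I\<close> up as far as possible: the last
  product outside \<open>I\<close> is a socle element. The pairing gives an inequality of
  dimensions, and exchanging the two degrees gives its converse.\<close>

lemma quotient_dim_symmetric:
  assumes I: "homogeneous_ideal I" and M: "\<And>n. n \<ge> M \<Longrightarrow> A n \<subseteq> I"
    and w: "w \<in> carrier R" "w \<notin> I" "\<And>i y. i > 0 \<Longrightarrow> y \<in> A i \<Longrightarrow> w \<otimes> y \<in> I"
    and span: "\<And>x. x \<in> carrier R \<Longrightarrow> (\<And>i y. i > 0 \<Longrightarrow> y \<in> A i \<Longrightarrow> x \<otimes> y \<in> I) \<Longrightarrow>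
      \<exists>c\<in>A 0. \<exists>z\<in>I. x = c \<otimes> w \<oplus> z"
  shows "\<exists>\<sigma>. (\<forall>n>\<sigma>. A n \<subseteq> I) \<and> (\<forall>i\<le>\<sigma>. quotient_dim I i = quotient_dim I (\<sigma> - i))"
proof -
  interpret I: ideal I R
    using I by (simp add: homogeneous_ideal_def)
  have comp: "component x i \<in> I" if "x \<in> I" for x i
    using I that by (simp add: homogeneous_ideal_def)
  have "\<exists>\<sigma>. component w \<sigma> \<notin> I"
  proof (rule ccontr)
    assume "\<not> ?thesis"
    then have "(\<Oplus>i\<in>{i. component w i \<noteq> \<zero>}. component w i) \<in> I"
      using finite_support[OF w(1)] by (intro I.finsum_mem) auto
    then show False
      using component_finsum[OF w(1)] w(2) by simp
  qed
  then obtain \<sigma> where \<sigma>: "component w \<sigma> \<notin> I"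
    by blast
  define w' where "w' = component w \<sigma>"
  have w': "w' \<in> A \<sigma>" "w' \<in> carrier R" "w' \<notin> I"
    using component_homogeneous[OF w(1)] w(1) \<sigma> by (auto simp: w'_def)
  have w'_soc: "w' \<otimes> y \<in> I" if "i > 0" "y \<in> A i" for i y
  proof -
    have yc: "y \<in> carrier R"
      using that homogeneous_carrier by blast
    have "component (y \<otimes> w) (i + \<sigma>) \<in> I"
      using w(3)[OF that] yc w(1) by (intro comp) (simp add: m_comm)
    then show ?thesis
      using component_mult[OF that(2) w(1)] yc w'(2) by (simp add: w'_def m_comm)
  qed
  have "\<exists>c\<in>A 0. \<exists>z\<in>I. w' = c \<otimes> w \<oplus> z"
    by (rule span[OF w'(2)]) (rule w'_soc)
  then obtain c\<^sub>0 z\<^sub>0 where c0: "c\<^sub>0 \<in> A 0" "z\<^sub>0 \<in> I" "w' = c\<^sub>0 \<otimes> w \<oplus> z\<^sub>0"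
    by blast
  have "c\<^sub>0 \<noteq> \<zero>"
    using c0 w' w(1) by auto
  then have "c\<^sub>0 \<in> A 0 - {\<zero>}"
    using c0 by simp
  note inv = subfield_m_inv[OF ground_field this]
  have span': "\<exists>c\<in>A 0. \<exists>z\<in>I. x = c \<otimes> w' \<oplus> z"
    if x: "x \<in> carrier R" "\<And>i y. i > 0 \<Longrightarrow> y \<in> A i \<Longrightarrow> x \<otimes> y \<in> I" for x
  proof -
    have "\<exists>c\<in>A 0. \<exists>z\<in>I. x = c \<otimes> w \<oplus> z"
      by (rule span[OF x(1)]) (rule x(2))
    then obtain c z where c: "c \<in> A 0" "z \<in> I" "x = c \<otimes> w \<oplus> z"
      by blast
    define k where "k = c \<otimes> inv c\<^sub>0"
    have k: "k \<in> A 0"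
      using mult_degree[OF c(1), of "inv c\<^sub>0" 0] inv(1) by (simp add: k_def)
    have car: "k \<in> carrier R" "c \<in> carrier R" "c\<^sub>0 \<in> carrier R" "inv c\<^sub>0 \<in> carrier R"
      "z \<in> carrier R" "z\<^sub>0 \<in> carrier R"
      using k c c0 inv homogeneous_carrier I.Icarr by auto
    have kc: "k \<otimes> c\<^sub>0 = c"
      using car inv(3) by (simp add: k_def m_assoc)
    have "k \<otimes> w' = c \<otimes> w \<oplus> k \<otimes> z\<^sub>0"
      using car w(1) by (simp add: c0(3) r_distr kc flip: m_assoc)
    moreover have "(p \<oplus> q) \<oplus> (\<ominus> q \<oplus> r) = p \<oplus> r"
      if "p \<in> carrier R" "q \<in> carrier R" "r \<in> carrier R" for p q r
      using that by algebra
    ultimately have "x = k \<otimes> w' \<oplus> (\<ominus> (k \<otimes> z\<^sub>0) \<oplus> z)"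
      using car w(1) by (simp add: c(3))
    moreover have "\<ominus> (k \<otimes> z\<^sub>0) \<oplus> z \<in> I"
      using c c0 car by (intro I.a_closed I.a_inv_closed I.I_l_closed)
    ultimately show ?thesis
      using k by blast
  qed
  \<comment> \<open>Such an \<open>x\<close> is a multiple of \<open>w'\<close> plus an element of
    \<open>I\<close>. If \<open>k\<close> differs from \<sigma>, the component of degree
    \<open>k\<close> comes from \<open>I\<close> alone.\<close>
  have degree: "k = \<sigma>"
    if x: "x \<in> A k" "x \<notin> I" "\<And>i y. i > 0 \<Longrightarrow> y \<in> A i \<Longrightarrow> x \<otimes> y \<in> I" for x k
  proof (rule ccontr)
    assume "k \<noteq> \<sigma>"
    have "\<exists>c\<in>A 0. \<exists>z\<in>I. x = c \<otimes> w' \<oplus> z"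
      by (rule span'[OF homogeneous_carrier[OF x(1)]]) (rule x(3))
    then obtain c z where c: "c \<in> A 0" "z \<in> I" "x = c \<otimes> w' \<oplus> z"
      by blast
    have "c \<otimes> w' \<in> A \<sigma>"
      using mult_degree[OF c(1) w'(1)] by simp
    then have "component (c \<otimes> w' \<oplus> z) k = component z k"
      using \<open>k \<noteq> \<sigma>\<close> c(2) I.Icarr homogeneous_carrier
      by (simp add: component_add component_of_homogeneous)
    then have "x = component z k"
      using component_of_homogeneous[OF x(1), of k] c(3) by simp
    then show False
      using comp[OF c(2)] x(2) by simp
  qed
  have nondeg: "i \<le> \<sigma> \<and> (\<exists>y\<in>A (\<sigma> - i). x \<otimes> y \<notin> I)" if x: "x \<in> A i" "x \<notin> I" for x i
  proof -
    have xc: "x \<in> carrier R"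
      using x homogeneous_carrier by blast
    define J where "J = {j. \<exists>y\<in>A j. x \<otimes> y \<notin> I}"
    have "j < M" if "j \<in> J" for j
    proof (rule ccontr)
      assume "\<not> j < M"
      then have "A (i + j) \<subseteq> I"
        by (intro M) simp
      then show False
        using that mult_degree[OF x(1)] by (auto simp: J_def)
    qed
    then have fin: "finite J"
      by (meson finite_nat_set_iff_bounded)
    have "0 \<in> J"
      using x xc by (auto simp: J_def intro!: bexI[of _ \<one>])
    \<comment> \<open>The largest degree in which \<open>x\<close> has a multiplier keeping it
      outside \<open>I\<close>; it exists because \<open>M\<close> bounds \<open>J\<close>. By
      maximality \<open>x \<otimes> y\<close> is killed modulo \<open>I\<close> by every positive
      degree.\<close>
    define m where "m = Max J"
    have "m \<in> J"
      using fin \<open>0 \<in> J\<close> unfolding m_def by (intro Max_in) auto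
    then obtain y where y: "y \<in> A m" "x \<otimes> y \<notin> I"
      by (auto simp: J_def)
    have yc: "y \<in> carrier R"
      using y homogeneous_carrier by blast
    have "(x \<otimes> y) \<otimes> y' \<in> I" if "j > 0" "y' \<in> A j" for j y'
    proof -
      have "m + j \<notin> J"
        using Max_ge[OF fin, of "m + j"] that(1) by (auto simp: m_def)
      then have "x \<otimes> (y \<otimes> y') \<in> I"
        using mult_degree[OF y(1) that(2)] by (auto simp: J_def)
      then show ?thesis
        using xc yc homogeneous_carrier[OF that(2)] by (simp add: m_assoc)
    qed
    then have "i + m = \<sigma>"
      by (rule degree[OF mult_degree[OF x(1) y(1)] y(2)])
    then show ?thesis
      using y by auto
  qed
  have above: "A n \<subseteq> I" if "n > \<sigma>" for n
    using nondeg that by (meson linorder_not_less subsetI)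
  have le: "quotient_dim I i \<le> quotient_dim I j" if ij: "i + j = \<sigma>" for i j
  proof -
    have "dim (A 0) (A i) + dim (A 0) (I \<inter> A j) \<le> dim (A 0) (A j) + dim (A 0) (I \<inter> A i)"
    proof (rule dim_le_of_nondegenerate_pairing[OF ground_field I.is_ideal w'(2)
          subalgebra_homogeneous finite_dimension_homogeneous
          subalgebra_homogeneous finite_dimension_homogeneous])
      fix u v assume uv: "u \<in> A i" "v \<in> A j"
      then have uv': "u \<otimes> v \<in> A \<sigma>"
        using mult_degree ij by blast
      \<comment> \<open>All degrees above \<sigma> lie in \<open>I\<close>, so an element of degree
        \<sigma> is automatically in the socle.\<close>
      show "\<exists>c\<in>A 0. \<exists>z\<in>I. u \<otimes> v = c \<otimes> w' \<oplus> z"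
      proof (rule span'[OF homogeneous_carrier[OF uv']])
        fix k :: nat and y assume "k > 0" "y \<in> A k"
        then show "u \<otimes> v \<otimes> y \<in> I"
          using above[of "\<sigma> + k"] mult_degree[OF uv'] by auto
      qed
    next
      fix u assume u: "u \<in> A i" "\<And>v. v \<in> A j \<Longrightarrow> u \<otimes> v \<in> I"
      have "\<sigma> - i = j"
        using ij by simp
      with u nondeg[OF u(1)] show "u \<in> I"
        by auto
    qed
    then show ?thesis
      by (simp add: quotient_dim_def)
  qed
  have "quotient_dim I i = quotient_dim I (\<sigma> - i)" if "i \<le> \<sigma>" for i
    using le[of i "\<sigma> - i"] le[of "\<sigma> - i" i] that by simp
  with above show ?thesis
    by blast
qed

text \<open>Dimension one means a line extension of the zero space; its spanning vector is a coset,
  and \<open>w\<close> is a representative. This turns the hypothesis on \<open>R Quot I\<close>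
  into congruences in \<open>R\<close>.\<close>

lemma quotient_socle_generator:
  assumes I: "ideal I R"
    and dim: "ring.dimension (R Quot I) 1 ((\<lambda>k. I +> k) ` A 0) (quotient_socle R A I)"
  obtains w where "w \<in> carrier R" "w \<notin> I" "\<And>i y. i > 0 \<Longrightarrow> y \<in> A i \<Longrightarrow> w \<otimes> y \<in> I"
    "\<And>x. x \<in> carrier R \<Longrightarrow> (\<And>i y. i > 0 \<Longrightarrow> y \<in> A i \<Longrightarrow> x \<otimes> y \<in> I) \<Longrightarrow>
      \<exists>c\<in>A 0. \<exists>z\<in>I. x = c \<otimes> w \<oplus> z"
proof -
  interpret I: ideal I R by fact
  interpret Q: ring "R Quot I"
    by (rule I.quotient_is_ring)
  have Q_simps: "carrier (R Quot I) = (\<lambda>x. I +> x) ` carrier R" "\<zero>\<^bsub>R Quot I\<^esub> = I"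
    by (auto simp: FactRing_def A_RCOSETS_def')
  have Q_mult: "(I +> x) \<otimes>\<^bsub>R Quot I\<^esub> (I +> y) = I +> (x \<otimes> y)"
    if "x \<in> carrier R" "y \<in> carrier R" for x y
    using that by (simp add: FactRing_def I.rcoset_mult_add)
  have coset_eq: "I +> x = I \<longleftrightarrow> x \<in> I" if "x \<in> carrier R" for x
    using I.rcos_const_imp_mem[OF that] I.a_rcos_const by blast
  obtain v E where v: "v \<in> carrier (R Quot I)" "v \<notin> E" "Q.dimension 0 ((\<lambda>k. I +> k) ` A 0) E"
    and soc: "quotient_socle R A I = Q.line_extension ((\<lambda>k. I +> k) ` A 0) v E"
    using dim by (cases rule: Q.dimension.cases) auto
  have E: "E = {\<zero>\<^bsub>R Quot I\<^esub>}"
    using v(3) by (cases rule: Q.dimension.cases) auto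
  obtain w where w: "w \<in> carrier R" "v = I +> w"
    using v(1) unfolding Q_simps by blast
  have wI: "w \<notin> I"
    using v(2) w coset_eq by (auto simp: E Q_simps)
  have A0: "c \<in> carrier R" if "c \<in> A 0" for c
    using that homogeneous_carrier by blast
  have soc_iff: "I +> x \<in> quotient_socle R A I \<longleftrightarrow> (\<forall>i>0. \<forall>y\<in>A i. x \<otimes> y \<in> I)"
    if "x \<in> carrier R" for x
    using that homogeneous_carrier
    by (auto simp: quotient_socle_def Q_mult coset_eq Q_simps)
  have line: "I +> x \<in> quotient_socle R A I \<longleftrightarrow> (\<exists>c\<in>A 0. I +> x = I +> (c \<otimes> w))" for x
  proof -
    have "(I +> c) \<otimes>\<^bsub>R Quot I\<^esub> v \<oplus>\<^bsub>R Quot I\<^esub> \<zero>\<^bsub>R Quot I\<^esub> = I +> (c \<otimes> w)" if "c \<in> A 0" for c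
    proof -
      have "I +> (c \<otimes> w) \<in> carrier (R Quot I)"
        using A0[OF that] w(1) by (auto simp: Q_simps)
      then show ?thesis
        using A0[OF that] w by (simp add: Q_mult)
    qed
    then show ?thesis
      by (auto simp: soc Q.line_extension_mem_iff E)
  qed
  have "I +> w \<in> quotient_socle R A I"
    unfolding line using w(1) by (intro bexI[of _ \<one>]) auto
  then have "w \<otimes> y \<in> I" if "i > 0" "y \<in> A i" for i y
    using soc_iff[OF w(1)] that by blast
  moreover have "\<exists>c\<in>A 0. \<exists>z\<in>I. x = c \<otimes> w \<oplus> z"
    if x: "x \<in> carrier R" "\<And>i y. i > 0 \<Longrightarrow> y \<in> A i \<Longrightarrow> x \<otimes> y \<in> I" for x
  proof -
    have "I +> x \<in> quotient_socle R A I"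
      using soc_iff[OF x(1)] x(2) by simp
    then obtain c where c: "c \<in> A 0" "I +> x = I +> (c \<otimes> w)"
      unfolding line by auto
    then have "x \<in> I +> (c \<otimes> w)"
      using I.a_rcos_self[OF x(1)] by simp
    then obtain z where z: "z \<in> I" "x = z \<oplus> c \<otimes> w"
      by (auto simp: a_r_coset_def')
    moreover have "z \<oplus> c \<otimes> w = c \<otimes> w \<oplus> z"
      using A0[OF c(1)] w(1) I.Icarr[OF z(1)] by (simp add: a_comm)
    ultimately show ?thesis
      using c(1) by auto
  qed
  ultimately show thesis
    by (rule that[OF w(1) wI])
qed

end

section \<open>The coefficient identity from a sequence witnessing type one\<close>

theorem corollary7p1:
  fixes R :: "('a, 'b) ring_scheme" and A :: "nat \<Rightarrow> 'a set"
    and d n :: nat and a s :: int and h \<phi> :: "complex fps"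
  assumes "positively_graded_domain R A"
    and "cohen_macaulay R A"
    and "krull_dim R = enat d"
    and "a = a_invariant R A"
    and "gorenstein R A"
    and "\<phi> = phi_series R A d"
    and "s = - (a + int d)"
  shows "fps_nth (h * \<phi>) n =
    fps_nth (fps_compose h (fps_X / (1 + fps_X)) * (1 + fps_X) powi (int n - 1 + s)
      * fps_compose \<phi> (- fps_X)) n"
proof -
  interpret positively_graded_domain R A by fact
  obtain \<theta> where \<theta>: "homogeneous_regular_sequence R A \<theta>" "enat (length \<theta>) = graded_depth R A"
    and soc: "ring.dimension (R Quot genideal R (set \<theta>)) 1
      ((\<lambda>k. genideal R (set \<theta>) +>\<^bsub>R\<^esub> k) ` A 0) (quotient_socle R A (genideal R (set \<theta>)))"
    using assms(5) by (auto simp: gorenstein_def Let_def)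
  define I where "I = genideal R (set \<theta>)"
  have d: "length \<theta> = d"
    using \<theta>(2) assms(2,3) by (simp add: cohen_macaulay_def)
  have \<theta>h: "\<forall>t\<in>set \<theta>. \<exists>e>0. t \<in> A e"
    and nzd: "\<And>i x. i < length \<theta> \<Longrightarrow> x \<in> carrier R \<Longrightarrow>
      \<theta> ! i \<otimes>\<^bsub>R\<^esub> x \<in> genideal R (set (take i \<theta>)) \<Longrightarrow> x \<in> genideal R (set (take i \<theta>))"
    and proper: "I \<noteq> carrier R"
    using \<theta>(1) by (auto simp: homogeneous_regular_sequence_def I_def)
  then obtain deg where deg: "\<And>t. t \<in> set \<theta> \<Longrightarrow> deg t > 0 \<and> t \<in> A (deg t)"
    by metis
  then have \<theta>h: "set \<theta> \<subseteq> (\<Union>i. A i)"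
    by blast
  then have \<theta>c: "set \<theta> \<subseteq> carrier R"
    by (auto dest: homogeneous_carrier)
  have hI: "homogeneous_ideal I"
    unfolding I_def by (rule homogeneous_ideal_genideal[OF \<theta>h])
  then interpret I: ideal I R
    by (simp add: homogeneous_ideal_def)
  \<comment> \<open>Regularity at a zero member would put \<open>\<one>\<close> into the ideal of
    its predecessors, against properness of \<open>I\<close>.\<close>
  have nz: "t \<noteq> \<zero>\<^bsub>R\<^esub>" if t: "t \<in> set \<theta>" for t
  proof
    assume "t = \<zero>\<^bsub>R\<^esub>"
    then obtain i where i: "i < length \<theta>" "\<theta> ! i = \<zero>\<^bsub>R\<^esub>"
      using t by (auto simp: in_set_conv_nth)
    have "set (take i \<theta>) \<subseteq> carrier R"
      using \<theta>c set_take_subset[of i \<theta>] by blast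
    then interpret J: ideal "genideal R (set (take i \<theta>))" R
      by (rule genideal_ideal)
    have "\<one>\<^bsub>R\<^esub> \<in> genideal R (set (take i \<theta>))"
      by (rule nzd[OF i(1) one_closed]) (simp add: i(2))
    moreover have "genideal R (set (take i \<theta>)) \<subseteq> I"
      using order_trans[OF set_take_subset genideal_self[OF \<theta>c]]
      unfolding I_def[symmetric] by (rule genideal_minimal[OF I.is_ideal])
    ultimately show False
      using proper I.one_imp_carrier by blast
  qed
  define es where "es = map deg \<theta>"
  have H: "hilbert_series R A * (\<Prod>e\<leftarrow>es. 1 - fps_X ^ e) = Abs_fps (\<lambda>n. of_int (quotient_dim I n))"
    unfolding I_def
    by (rule hilbert_series_mult_prod[OF _ nzd])
      (use deg nz in \<open>auto simp: es_def list_all2_map2 list.rel_refl_strong\<close>)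
  obtain M where M: "\<And>n. n \<ge> M \<Longrightarrow> A n \<subseteq> I"
    using cofinite_regular_sequence[OF _ \<theta>(1)] assms(3) d by (auto simp: I_def)
  have "\<exists>\<sigma>. (\<forall>n>\<sigma>. A n \<subseteq> I) \<and> (\<forall>i\<le>\<sigma>. quotient_dim I i = quotient_dim I (\<sigma> - i))"
  proof (rule quotient_socle_generator[OF I.is_ideal soc[folded I_def]])
    fix w
    assume w: "w \<in> carrier R" "w \<notin> I" "\<And>i y. i > 0 \<Longrightarrow> y \<in> A i \<Longrightarrow> w \<otimes>\<^bsub>R\<^esub> y \<in> I"
      "\<And>x. x \<in> carrier R \<Longrightarrow> (\<And>i y. i > 0 \<Longrightarrow> y \<in> A i \<Longrightarrow> x \<otimes>\<^bsub>R\<^esub> y \<in> I) \<Longrightarrow>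
        \<exists>c\<in>A 0. \<exists>z\<in>I. x = c \<otimes>\<^bsub>R\<^esub> w \<oplus>\<^bsub>R\<^esub> z"
    show ?thesis
      by (rule quotient_dim_symmetric[OF hI M w])
  qed
  then obtain \<sigma>
    where \<sigma>: "\<And>n. n > \<sigma> \<Longrightarrow> A n \<subseteq> I" "\<And>i. i \<le> \<sigma> \<Longrightarrow> quotient_dim I i = quotient_dim I (\<sigma> - i)"
    by auto
  have "quotient_dim I n = 0" if "n > \<sigma>" for n
  proof -
    have "I \<inter> A n = A n"
      using \<sigma>(1)[OF that] by auto
    then show ?thesis
      by (simp add: quotient_dim_def)
  qed
  \<comment> \<open>The ideal is proper, so degree zero of the quotient is the ground field; this
    makes \<open>p\<close> nonzero and fixes its degree as \<sigma>.\<close>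
  moreover have "quotient_dim I 0 \<noteq> 0"
    using quotient_dim_0[OF I.is_ideal proper] by simp
  ultimately obtain p :: "complex poly" where p: "reflect_poly p = p" "p \<noteq> 0"
    and fps: "fps_of_poly p = Abs_fps (\<lambda>n. of_int (quotient_dim I n))"
    using palindromic_sequence_poly[of \<sigma> "quotient_dim I"] \<sigma>(2) by blast
  show ?thesis
  proof (rule coeff_mult_phi_series[OF _ p])
    show "hilbert_series R A * (\<Prod>e\<leftarrow>es. 1 - fps_X ^ e) = fps_of_poly p"
      using H fps by simp
  qed (use deg d assms(4,6,7) in \<open>auto simp: es_def\<close>)
qed

end
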